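(* Let $T_n$ be a $2$-dimensional determinantal hypertree on $n$ vertices, and let $G$ be a finite abelian group. Then \[\lim_{n\to\infty}\frac{\log \mathbb{E}|Z^1(T_n,G)|}{n^2}=0.\]
   Context: A $2$-dimensional simplicial complex $S$ on the vertex set $[n]=\{1,\dots,n\}$ is called a ($2$-dimensional) hypertree if (a) $S$ has complete $1$-skeleton (all vertices and all edges of the complete graph on $[n]$ are in $S$); (b) the number of triangular faces of $S$ is $\binom{n-1}{2}$; (c) the homology group $H_1(S,\mathbb{Z})$ is finite. By Kalai's formula, $\sum_S |H_1(S,\mathbb{Z})|^2=n^{\binom{n-2}{2}}$, where the sum is over all hypertrees $S$ on $[n]$. The ($2$-dimensional) determinantal hypertree $T_n$ on $n$ vertices is the random hypertree on $[n]$ which equals $S$ with probability $|H_1(S,\mathbb{Z})|^2/n^{\binom{n-2}{2}}$ for each hypertree $S$. For a simplicial complex $X$ on $[n]$ with complete $1$-skeleton, $Z^1(X,G)$ is the group of $1$-cocycles with coefficients in $G$, i.e., the functions $f:\{(u,v)\in[n]^2: u\ne v\}\to G$ with $f(u,v)=-f(v,u)$ for all $u\neq v$, and $f(u,v)+f(v,w)+f(w,u)=0$ for every triangular face $\{u,v,w\}$ of $X$. *)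

theory Defs
  imports
    "HOL-Probability.Probability"
    "HOL-Algebra.Free_Abelian_Groups"
begin

text \<open>Abstract simplicial complexes are represented by their sets of nonempty faces. (The library's
  \<open>simplicial_complex\<close> from \<open>Polytope\<close> is a geometric notion and does not apply here.)\<close>

definition abstract_complex :: "'a set \<Rightarrow> 'a set set \<Rightarrow> bool" where
  "abstract_complex V X \<longleftrightarrow>
     (\<forall>\<sigma>\<in>X. \<sigma> \<noteq> {} \<and> finite \<sigma> \<and> \<sigma> \<subseteq> V) \<and>
     (\<forall>\<sigma>\<in>X. \<forall>\<tau>. \<tau> \<noteq> {} \<and> \<tau> \<subseteq> \<sigma> \<longrightarrow> \<tau> \<in> X)"

definition faces_of_dim :: "nat \<Rightarrow> 'a set set \<Rightarrow> 'a set set" where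
  "faces_of_dim k X = {\<sigma> \<in> X. card \<sigma> = k + 1}"

text \<open>Every simplex carries the orientation given by the linear order of its vertices: writing
  \<open>\<sigma> = {v\<^sub>0 < \<dots> < v\<^sub>k}\<close>, the vertex \<open>v\<^sub>i\<close> has exactly \<open>i\<close> smaller vertices in \<open>\<sigma>\<close>, so that
  the map below sends \<open>\<sigma>\<close> to the sum of \<open>(-1)\<^sup>i (\<sigma> - {v\<^sub>i})\<close>. Homology is not reduced,
  hence the boundary in dimension \<open>0\<close> is zero.\<close>

definition simplicial_boundary :: "nat \<Rightarrow> (('a::linorder) set \<Rightarrow>\<^sub>0 int) \<Rightarrow> ('a set \<Rightarrow>\<^sub>0 int)" where
  "simplicial_boundary k c =
     (if k = 0 then 0
      else frag_extend
        (\<lambda>\<sigma>. \<Sum>v\<in>\<sigma>. frag_cmul ((-1) ^ card {w\<in>\<sigma>. w < v}) (frag_of (\<sigma> - {v}))) c)"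

definition simplicial_chains :: "nat \<Rightarrow> 'a set set \<Rightarrow> ('a set \<Rightarrow>\<^sub>0 int) monoid" where
  "simplicial_chains k X = free_Abelian_group (faces_of_dim k X)"

definition simplicial_cycles :: "nat \<Rightarrow> ('a::linorder) set set \<Rightarrow> ('a set \<Rightarrow>\<^sub>0 int) set" where
  "simplicial_cycles k X = {c \<in> carrier (simplicial_chains k X). simplicial_boundary k c = 0}"

definition simplicial_boundaries :: "nat \<Rightarrow> ('a::linorder) set set \<Rightarrow> ('a set \<Rightarrow>\<^sub>0 int) set" where
  "simplicial_boundaries k X =
     simplicial_boundary (Suc k) ` carrier (simplicial_chains (Suc k) X)"

definition simplicial_homology ::
    "nat \<Rightarrow> ('a::linorder) set set \<Rightarrow> (('a set \<Rightarrow>\<^sub>0 int) set) monoid" where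
  "simplicial_homology k X =
     subgroup_generated (simplicial_chains k X) (simplicial_cycles k X)
       Mod simplicial_boundaries k X"

text \<open>The vertex set \<open>[n]\<close> is \<open>{1..n}\<close>. For \<open>n \<ge> 3\<close> the number of triangles forces the dimension
  to be exactly \<open>2\<close>.\<close>

definition hypertree :: "nat \<Rightarrow> nat set set \<Rightarrow> bool" where
  "hypertree n S \<longleftrightarrow>
     abstract_complex {1..n} S \<and> (\<forall>\<sigma>\<in>S. card \<sigma> \<le> 3) \<and>
     (\<forall>v\<in>{1..n}. {v} \<in> S) \<and>
     (\<forall>u\<in>{1..n}. \<forall>v\<in>{1..n}. u \<noteq> v \<longrightarrow> {u, v} \<in> S) \<and>
     card (faces_of_dim 2 S) = (n - 1) choose 2 \<and>
     finite (carrier (simplicial_homology 1 S))"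

text \<open>\<open>T\<close>, defined on the probability space \<open>M\<close>, is a determinantal hypertree on \<open>[n]\<close>. That the
  prescribed probabilities add up to \<open>1\<close> is Kalai's formula. The exponent uses truncated
  subtraction, so this is meant for \<open>n \<ge> 2\<close>.\<close>

definition determinantal_hypertree :: "nat \<Rightarrow> 'a measure \<Rightarrow> ('a \<Rightarrow> nat set set) \<Rightarrow> bool" where
  "determinantal_hypertree n M T \<longleftrightarrow>
     prob_space M \<and> T \<in> measurable M (count_space {S. hypertree n S}) \<and>
     (\<forall>S. hypertree n S \<longrightarrow>
        measure M {\<omega> \<in> space M. T \<omega> = S} =
          real (order (simplicial_homology 1 S)) ^ 2 / real n ^ ((n - 2) choose 2))"

text \<open>The \<open>1\<close>-cocycles of a complex on \<open>[n]\<close> with complete \<open>1\<close>-skeleton, for an abelian group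
  \<open>G\<close> written multiplicatively. Extensionality outside the set of ordered pairs makes the
  cardinality of this set the right one.\<close>

definition cocycles1 ::
    "nat \<Rightarrow> nat set set \<Rightarrow> ('g, 'm) monoid_scheme \<Rightarrow> (nat \<times> nat \<Rightarrow> 'g) set" where
  "cocycles1 n X G =
     {f \<in> {(u, v). u \<in> {1..n} \<and> v \<in> {1..n} \<and> u \<noteq> v} \<rightarrow>\<^sub>E carrier G.
        (\<forall>u\<in>{1..n}. \<forall>v\<in>{1..n}. u \<noteq> v \<longrightarrow> f (u, v) = inv\<^bsub>G\<^esub> f (v, u)) \<and>
        (\<forall>u v w. {u, v, w} \<in> faces_of_dim 2 X \<longrightarrow>
           f (u, v) \<otimes>\<^bsub>G\<^esub> f (v, w) \<otimes>\<^bsub>G\<^esub> f (w, u) = \<one>\<^bsub>G\<^esub>)}"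

end

theory Submission
  imports Defs "HOL-Combinatorics.Permutations" "HOL-Real_Asymp.Real_Asymp"
begin

text \<open>The expectation is the sum over all alternating \<open>h\<close> of the probability that every triangle of
  the hypertree is closed for \<open>h\<close>. Since \<open>|H\<^sub>1(S)|\<close> is at most the absolute value of the determinant of
  the boundary matrix of \<open>S\<close> with the edges at the vertex \<open>1\<close> deleted, the Cauchy-Binet formula and
  Hadamard's inequality bound this probability by \<open>n\<^bsup>n-2\<^esup>\<close> times the product over the edges \<open>e\<close> of
  \<open>d(e) / n\<close>, where \<open>d(e)\<close> counts the closed triangles containing \<open>e\<close>. For a random sample of \<open>k\<close>
  vertices, with \<open>X(e)\<close> of them closing \<open>e\<close>, the mean of \<open>(d(e) / n) / ((X(e) + 1) / (k + 1))\<close> is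
  at most \<open>1\<close>, so some sample makes the product of the \<open>d(e) / n\<close> at most that of the
  \<open>(X(e) + 1) / (k + 1)\<close>. But given \<open>h\<close> on the \<open>O(k n)\<close> edges that meet the sample, the numbers
  \<open>(X(e) + 1) / (k + |G|)\<close> are probability distributions in the value \<open>h(e)\<close>. Hence the expectation
  is at most \<open>((k + |G|) / (k + 1))\<close> to the power \<open>n\<^sup>2 / 2\<close>, up to a factor \<open>exp (O(k n ln n))\<close>, and
  \<open>k\<close> is arbitrary.\<close>

subsection \<open>Determinants and indices of lattices\<close>

text \<open>The determinant of the matrix with entry \<open>c j i\<close> in row \<open>i\<close> and column \<open>j\<close>, expanded along
  the last row: moving column \<open>n\<close> into the place of the deleted column \<open>j < n\<close> is, up to the sign
  \<open>-1\<close>, the usual cofactor.\<close>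

fun cdet :: "nat \<Rightarrow> (nat \<Rightarrow> nat \<Rightarrow> int) \<Rightarrow> int" where
  "cdet 0 c = 1"
| "cdet (Suc n) c = c n n * cdet n c - (\<Sum>j<n. c j n * cdet n (c(j := c n)))"

section \<open>Alternating multilinearity of the determinant in its columns\<close>

lemma cdet_cong:
  "(\<And>j i. j < n \<Longrightarrow> i < n \<Longrightarrow> c j i = d j i) \<Longrightarrow> cdet n c = cdet n d"
proof (induction n arbitrary: c d)
  case (Suc n)
  have "cdet n c = cdet n d"
    using Suc.prems by (intro Suc.IH) auto
  moreover have "cdet n (c(j := c n)) = cdet n (d(j := d n))" if "j < n" for j
    using Suc.prems that by (intro Suc.IH) auto
  ultimately show ?case
    using Suc.prems by simp
qed simp

text \<open>Induction on the size. Swapping with the last column exchanges the leading term of the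
  expansion with the \<open>j\<close>-th one and negates the others by the induction hypothesis.
  Swapping two earlier columns permutes the terms by the transposition, each with a sign.\<close>

lemma cdet_swap:
  "\<lbrakk>j < n; l < n; j \<noteq> l\<rbrakk> \<Longrightarrow> cdet n (c(j := c l, l := c j)) = - cdet n c"
proof (induction n arbitrary: c j l)
  case (Suc n)
  have last: "cdet (Suc n) (c(j := c n, n := c j)) = - cdet (Suc n) c" if "j < n" for c j
  proof -
    let ?c = "c(j := c n, n := c j)"
    have 1: "cdet n ?c = cdet n (c(j := c n))"
      using that by (intro cdet_cong) auto
    have 2: "cdet n (?c(j := ?c n)) = cdet n c"
      using that by (intro cdet_cong) auto
    have 3: "cdet n (?c(m := ?c n)) = - cdet n (c(m := c n))" if m: "m < n" "m \<noteq> j" for m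
    proof -
      let ?d = "c(m := c n)"
      have "cdet n (?c(m := ?c n)) = cdet n (?d(j := ?d m, m := ?d j))"
        using m by (intro cdet_cong) auto
      also have "\<dots> = - cdet n ?d"
        using Suc.IH[of j m ?d] m \<open>j < n\<close> by blast
      finally show ?thesis .
    qed
    have sum: "(\<Sum>m<n. f m) = f j + (\<Sum>m\<in>{..<n} - {j}. f m)" for f :: "nat \<Rightarrow> int"
      using that by (intro sum.remove) auto
    have rest: "(\<Sum>m\<in>{..<n} - {j}. ?c m n * cdet n (?c(m := ?c n)))
        = - (\<Sum>m\<in>{..<n} - {j}. c m n * cdet n (c(m := c n)))"
      unfolding sum_negf[symmetric]
    proof (rule sum.cong)
      fix m assume m: "m \<in> {..<n} - {j}"
      have "?c m n = c m n" using m by auto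
      then show "?c m n * cdet n (?c(m := ?c n)) = - (c m n * cdet n (c(m := c n)))"
        using 3[of m] m by (simp del: fun_upd_apply)
    qed simp
    have e: "?c j n = c n n" "?c n n = c j n" using that by auto
    show ?thesis
      unfolding cdet.simps sum rest 1 2 e by simp
  qed
  consider "j < n" "l < n" | "j < n" "l = n" | "l < n" "j = n"
    using Suc.prems by linarith
  then show ?case
  proof cases
    case 1
    let ?c = "c(j := c l, l := c j)"
    have A: "cdet n ?c = - cdet n c"
      using Suc.IH[of j l c] 1 Suc.prems(3) by blast
    have B: "cdet n (?c(m := ?c n)) = - cdet n (c(Transposition.transpose j l m := c n))" if "m < n" for m
    proof -
      let ?d = "c(Transposition.transpose j l m := c n)"
      have "(?c(m := ?c n)) x = (?d(j := ?d l, l := ?d j)) x" for x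
        using 1 Suc.prems(3) that unfolding Transposition.transpose_def
        by (cases "m = j"; cases "m = l"; cases "x = j"; cases "x = l"; simp)
      then have "cdet n (?c(m := ?c n)) = cdet n (?d(j := ?d l, l := ?d j))"
        by (intro cdet_cong) simp
      also have "\<dots> = - cdet n ?d"
        using Suc.IH[of j l ?d] 1 Suc.prems(3) by blast
      finally show ?thesis .
    qed
    have C: "?c m n = c (Transposition.transpose j l m) n" for m
      using Suc.prems by (auto simp: Transposition.transpose_def)
    have "(\<Sum>m<n. ?c m n * cdet n (?c(m := ?c n)))
        = (\<Sum>m<n. - (c (Transposition.transpose j l m) n * cdet n (c(Transposition.transpose j l m := c n))))"
      using B by (intro sum.cong) (simp_all add: C del: fun_upd_apply)
    also have "\<dots> = (\<Sum>m<n. - (c m n * cdet n (c(m := c n))))"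
      using 1 by (intro sum.reindex_bij_witness[of _ "Transposition.transpose j l" "Transposition.transpose j l"])
        (auto simp: Transposition.transpose_def)
    finally have D: "(\<Sum>m<n. ?c m n * cdet n (?c(m := ?c n))) = - (\<Sum>m<n. c m n * cdet n (c(m := c n)))"
      by (simp add: sum_negf)
    have E: "?c n n = c n n" using 1 by auto
    show ?thesis
      unfolding cdet.simps D E A by simp
  next
    case 2
    show ?thesis unfolding \<open>l = n\<close> by (rule last[OF \<open>j < n\<close>])
  next
    case 3
    then have "c(j := c l, l := c j) = c(l := c n, n := c l)" by auto
    then show ?thesis using last[OF \<open>l < n\<close>] by (simp only:)
  qed
qed simp

lemma cdet_equal_columns:
  assumes "j < n" "l < n" "j \<noteq> l" "c j = c l"
  shows "cdet n c = 0"
proof -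
  have "c(j := c l, l := c j) = c" using assms(4) by auto
  then show ?thesis using cdet_swap[OF assms(1-3), of c] by simp
qed

text \<open>The last column enters each term of the expansion exactly once. An earlier column
  \<open>l\<close> enters the \<open>l\<close>-th term only through the coefficient
  \<open>c l n\<close>, and every other term through a smaller determinant covered by the induction
  hypothesis.\<close>

lemma cdet_linear:
  "l < n \<Longrightarrow> cdet n (c(l := \<lambda>i. x i + t * y i)) = cdet n (c(l := x)) + t * cdet n (c(l := y))"
proof (induction n arbitrary: c l x y)
  case (Suc n)
  show ?case
  proof (cases "l = n")
    case True
    have "cdet n (c(n := z, j := z)) = cdet n (c(j := z))" "cdet n (c(n := z)) = cdet n c"
      if "j < n" for j z
      using that by (auto intro!: cdet_cong)
    moreover have "cdet n (c(n := z)) = cdet n c" for z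
      by (auto intro!: cdet_cong)
    ultimately have expand: "cdet (Suc n) (c(n := z)) = z n * cdet n c - (\<Sum>j<n. c j n * cdet n (c(j := z)))" for z
      by simp
    have "(\<Sum>j<n. c j n * cdet n (c(j := \<lambda>i. x i + t * y i)))
        = (\<Sum>j<n. c j n * cdet n (c(j := x))) + t * (\<Sum>j<n. c j n * cdet n (c(j := y)))"
      unfolding sum_distrib_left sum.distrib[symmetric]
    proof (intro sum.cong refl)
      fix j assume "j \<in> {..<n}"
      then have "cdet n (c(j := \<lambda>i. x i + t * y i)) = cdet n (c(j := x)) + t * cdet n (c(j := y))"
        using Suc.IH[of j c x y] by blast
      then show "c j n * cdet n (c(j := \<lambda>i. x i + t * y i))
          = c j n * cdet n (c(j := x)) + t * (c j n * cdet n (c(j := y)))"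
        by (simp only: algebra_simps)
    qed
    then show ?thesis
      unfolding True expand by (simp add: algebra_simps)
  next
    case False
    then have l: "l < n" using Suc.prems by simp
    have neq: "cdet n (c(l := \<lambda>i. x i + t * y i, j := c n))
        = cdet n (c(l := x, j := c n)) + t * cdet n (c(l := y, j := c n))" if "j \<noteq> l" for j
      using Suc.IH[OF l, of "c(j := c n)" x y] by (simp only: fun_upd_twist[OF that])
    have sum: "(\<Sum>m<n. f m) = f l + (\<Sum>m\<in>{..<n} - {l}. f m)" for f :: "nat \<Rightarrow> int"
      using l by (intro sum.remove) auto
    have rest: "(\<Sum>m\<in>{..<n} - {l}. (c(l := \<lambda>i. x i + t * y i)) m n * cdet n (c(l := \<lambda>i. x i + t * y i, m := c n)))
      = (\<Sum>m\<in>{..<n} - {l}. (c(l := x)) m n * cdet n (c(l := x, m := c n))) +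
        t * (\<Sum>m\<in>{..<n} - {l}. (c(l := y)) m n * cdet n (c(l := y, m := c n)))"
      unfolding sum_distrib_left sum.distrib[symmetric]
      by (intro sum.cong) (auto simp: neq algebra_simps)
    have n: "(c(l := z)) n = c n" for z using l by simp
    show ?thesis
      unfolding cdet.simps n sum rest Suc.IH[OF l] by (simp add: algebra_simps)
  qed
qed simp

lemma cdet_add_column:
  assumes "j < n" "l < n" "j \<noteq> l"
  shows "cdet n (c(l := \<lambda>i. c l i + t * c j i)) = cdet n c"
proof -
  have "cdet n (c(l := c j)) = 0"
    using assms by (intro cdet_equal_columns[of j n l]) auto
  then show ?thesis
    using cdet_linear[of l n c "c l" t "c j"] assms by simp
qed

section \<open>Sums of squared determinants over all choices of columns\<close>

text \<open>Resampling one coordinate does not change a uniform average: exchanging the new value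
  \<open>y\<close> with the old value \<open>c j\<close> is an involution of the pairs
  \<open>(c, y)\<close>.\<close>

lemma sum_PiE_fun_upd:
  fixes f :: "_ \<Rightarrow> 'b::comm_semiring_1"
  assumes "finite T" "j \<in> I"
  shows "(\<Sum>c\<in>I \<rightarrow>\<^sub>E T. \<Sum>y\<in>T. f (c(j := y))) = of_nat (card T) * (\<Sum>c\<in>I \<rightarrow>\<^sub>E T. f c)"
proof -
  have "(\<Sum>c\<in>I \<rightarrow>\<^sub>E T. \<Sum>y\<in>T. f (c(j := y))) = (\<Sum>(c, y)\<in>(I \<rightarrow>\<^sub>E T) \<times> T. f (c(j := y)))"
    by (simp add: sum.cartesian_product)
  also have "\<dots> = (\<Sum>(c, y)\<in>(I \<rightarrow>\<^sub>E T) \<times> T. f c)"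
    using assms(2)
    by (intro sum.reindex_bij_witness[of _ "\<lambda>(c, y). (c(j := y), c j)" "\<lambda>(c, y). (c(j := y), c j)"])
      (auto simp: PiE_iff extensional_def)
  also have "\<dots> = (\<Sum>c\<in>I \<rightarrow>\<^sub>E T. \<Sum>y\<in>T. f c)"
    by (rule sum.cartesian_product[symmetric])
  finally show ?thesis by (simp add: sum_distrib_left)
qed

lemma sum_PiE_lessThan_Suc:
  "(\<Sum>c\<in>{..<Suc n} \<rightarrow>\<^sub>E T. f c) = (\<Sum>c\<in>{..<n} \<rightarrow>\<^sub>E T. \<Sum>y\<in>T. f (c(n := y)))"
proof -
  have "(\<Sum>c\<in>{..<Suc n} \<rightarrow>\<^sub>E T. f c) = (\<Sum>(y, c)\<in>T \<times> ({..<n} \<rightarrow>\<^sub>E T). f (c(n := y)))"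
    unfolding lessThan_Suc PiE_insert_eq
    by (subst sum.reindex[OF inj_combinator]) (auto simp: case_prod_unfold)
  also have "\<dots> = (\<Sum>y\<in>T. \<Sum>c\<in>{..<n} \<rightarrow>\<^sub>E T. f (c(n := y)))"
    by (rule sum.cartesian_product[symmetric])
  also have "\<dots> = (\<Sum>c\<in>{..<n} \<rightarrow>\<^sub>E T. \<Sum>y\<in>T. f (c(n := y)))"
    by (rule sum.swap)
  finally show ?thesis .
qed

text \<open>The wedge product with a vector of norm \<open>\<rho>\<close> multiplies the norm of a multivector by at most
  \<open>\<rho>\<close>: the defect is the squared norm of a contraction, computed in \<open>pos\<close> below.\<close>

lemma sum_cdet_squared_le:
  fixes r :: "'t \<Rightarrow> nat \<Rightarrow> int"
  assumes fin: "finite T"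
  shows "(\<Sum>c\<in>{..<n} \<rightarrow>\<^sub>E T. (cdet n (r \<circ> c))\<^sup>2) \<le> fact n * (\<Prod>i<n. \<Sum>t\<in>T. (r t i)\<^sup>2)"
proof (induction n)
  case (Suc n)
  define w where "w c = cdet n (r \<circ> c)" for c
  define \<Delta> where "\<Delta> c = cdet (Suc n) (r \<circ> c)" for c
  define \<rho> where "\<rho> = (\<Sum>t\<in>T. (r t n)\<^sup>2)"
  let ?C = "{..<n} \<rightarrow>\<^sub>E T" and ?C' = "{..<Suc n} \<rightarrow>\<^sub>E T"
  have \<Delta>: "\<Delta> c = r (c n) n * w c - (\<Sum>j<n. r (c j) n * w (c(j := c n)))" for c
    by (simp add: \<Delta>_def w_def fun_upd_comp)
  have w_n: "w (c(n := y)) = w c" for c y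
    unfolding w_def by (intro cdet_cong) auto
  \<comment> \<open>Exchanging the chosen columns \<open>j\<close> and \<open>n\<close> negates
    \<open>\<Delta>\<close> and turns the \<open>j\<close>-th term of the expansion into the leading
    one. So after multiplication by \<open>\<Delta>\<close> and summation all \<open>n + 1\<close>
    signed terms agree, which produces the factor \<open>Suc n\<close> in \<open>D\<close>.\<close>
  have swap: "(\<Sum>c\<in>?C'. \<Delta> c * (r (c j) n * w (c(j := c n)))) = - (\<Sum>c\<in>?C'. \<Delta> c * (r (c n) n * w c))"
    if "j < n" for j
    unfolding sum_negf[symmetric]
  proof (rule sum.reindex_bij_witness[of _ "\<lambda>c. c(j := c n, n := c j)" "\<lambda>c. c(j := c n, n := c j)"])
    fix c
    have "\<Delta> (c(j := c n, n := c j)) = - \<Delta> c"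
      unfolding \<Delta>_def using cdet_swap[of j "Suc n" n "r \<circ> c"] that by (simp add: fun_upd_comp)
    moreover have "w (c(j := c n, n := c j)) = w (c(j := c n))"
      by (rule w_n)
    ultimately show "- (\<Delta> (c(j := c n, n := c j)) * (r ((c(j := c n, n := c j)) n) n * w (c(j := c n, n := c j))))
        = \<Delta> c * (r (c j) n * w (c(j := c n)))"
      by simp
  qed (use that in \<open>auto simp: PiE_iff extensional_def\<close>)
  have "(\<Sum>c\<in>?C'. (\<Delta> c)\<^sup>2)
      = (\<Sum>c\<in>?C'. \<Delta> c * (r (c n) n * w c) - (\<Sum>j<n. \<Delta> c * (r (c j) n * w (c(j := c n)))))"
  proof (intro sum.cong refl)
    fix c
    show "(\<Delta> c)\<^sup>2 = \<Delta> c * (r (c n) n * w c) - (\<Sum>j<n. \<Delta> c * (r (c j) n * w (c(j := c n))))"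
      unfolding sum_distrib_left[symmetric] power2_eq_square
      by (subst (2) \<Delta>) (simp add: right_diff_distrib)
  qed
  also have "\<dots> = (\<Sum>c\<in>?C'. \<Delta> c * (r (c n) n * w c))
      - (\<Sum>j<n. \<Sum>c\<in>?C'. \<Delta> c * (r (c j) n * w (c(j := c n))))"
    by (simp add: sum_subtractf sum.swap[of _ _ ?C'])
  also have "\<dots> = int (Suc n) * (\<Sum>c\<in>?C'. \<Delta> c * (r (c n) n * w c))"
    by (simp add: swap algebra_simps)
  finally have D: "(\<Sum>c\<in>?C'. (\<Delta> c)\<^sup>2) = int (Suc n) * (\<Sum>c\<in>?C'. \<Delta> c * (r (c n) n * w c))" .
  have pos: "(\<Sum>c\<in>?C. \<Sum>y\<in>T. r (c j) n * r y n * w c * w (c(j := y))) \<ge> 0" if j: "j < n" for j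
  proof (cases "T = {}")
    case False
    \<comment> \<open>\<open>\<Phi> c\<close> does not depend on \<open>c j\<close>, so resampling
      coordinate \<open>j\<close> turns the sum of \<open>g\<close> into a sum of squares. The
      factor \<open>card T\<close> is divided out afterwards, hence the separate case of empty
      \<open>T\<close>.\<close>
    define \<Phi> where "\<Phi> c = (\<Sum>y\<in>T. r y n * w (c(j := y)))" for c
    define g where "g c = r (c j) n * w c * \<Phi> c" for c
    have "int (card T) * (\<Sum>c\<in>?C. g c) = (\<Sum>c\<in>?C. \<Sum>y\<in>T. g (c(j := y)))"
      using sum_PiE_fun_upd[OF fin, of j "{..<n}" g] j by simp
    also have "\<dots> = (\<Sum>c\<in>?C. (\<Phi> c)\<^sup>2)"
      by (intro sum.cong) (auto simp: g_def \<Phi>_def power2_eq_square sum_distrib_right)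
    also have "\<dots> \<ge> 0" by (intro sum_nonneg) auto
    finally have "(\<Sum>c\<in>?C. g c) \<ge> 0"
      using False fin by (simp add: zero_le_mult_iff card_gt_0_iff)
    then show ?thesis
      by (simp add: g_def \<Phi>_def sum_distrib_left algebra_simps)
  qed simp
  have "(\<Sum>c\<in>?C'. \<Delta> c * (r (c n) n * w c))
      = (\<Sum>c\<in>?C. \<Sum>y\<in>T. (r y n)\<^sup>2 * (w c)\<^sup>2 - (\<Sum>j<n. r (c j) n * r y n * w c * w (c(j := y))))"
    unfolding sum_PiE_lessThan_Suc
  proof (intro sum.cong refl)
    fix c y
    have "w (c(n := y, j := y)) = w (c(j := y))" if "j < n" for j
      using w_n[of "c(j := y)" y] that by (simp add: fun_upd_twist)
    then have \<Delta>': "\<Delta> (c(n := y)) = r y n * w c - (\<Sum>j<n. r (c j) n * w (c(j := y)))"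
      by (simp add: \<Delta> w_n)
    show "\<Delta> (c(n := y)) * (r ((c(n := y)) n) n * w (c(n := y)))
        = (r y n)\<^sup>2 * (w c)\<^sup>2 - (\<Sum>j<n. r (c j) n * r y n * w c * w (c(j := y)))"
      unfolding \<Delta>' by (simp add: w_n power2_eq_square algebra_simps sum_distrib_left)
  qed
  also have "\<dots> = \<rho> * (\<Sum>c\<in>?C. (w c)\<^sup>2)
      - (\<Sum>j<n. \<Sum>c\<in>?C. \<Sum>y\<in>T. r (c j) n * r y n * w c * w (c(j := y)))"
    by (simp add: sum_subtractf sum_distrib_left sum_distrib_right \<rho>_def sum.swap[of _ "{..<n}"])
  also have "\<dots> \<le> \<rho> * (\<Sum>c\<in>?C. (w c)\<^sup>2)"
    by (simp, rule sum_nonneg, rule pos, simp)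
  also have "\<dots> \<le> \<rho> * (fact n * (\<Prod>i<n. \<Sum>t\<in>T. (r t i)\<^sup>2))"
    unfolding w_def using Suc.IH by (rule mult_left_mono) (auto simp: \<rho>_def intro: sum_nonneg)
  finally have "(\<Sum>c\<in>?C'. (\<Delta> c)\<^sup>2) \<le> int (Suc n) * (\<rho> * (fact n * (\<Prod>i<n. \<Sum>t\<in>T. (r t i)\<^sup>2)))"
    unfolding D by (rule mult_left_mono) simp
  then show ?case
    by (simp add: \<Delta>_def \<rho>_def mult_ac del: cdet.simps o_apply)
qed simp

section \<open>The lattice spanned by the columns and its index\<close>

text \<open>Vectors of length \<open>n\<close> are functions on all naturals whose values from
  \<open>n\<close> on are unconstrained, so differences of such functions represent the quotient of
  the integer lattice of rank \<open>n\<close>.\<close>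

definition column_span :: "nat \<Rightarrow> (nat \<Rightarrow> nat \<Rightarrow> int) \<Rightarrow> (nat \<Rightarrow> int) set" where
  "column_span n c = {v. \<exists>x. \<forall>i<n. v i = (\<Sum>j<n. x j * c j i)}"

lemma column_span_add_column:
  assumes "j < n" "l < n" "j \<noteq> l"
  shows "column_span n (c(l := \<lambda>i. c l i + t * c j i)) \<subseteq> column_span n c"
proof
  fix v assume "v \<in> column_span n (c(l := \<lambda>i. c l i + t * c j i))"
  then obtain x where x: "v i = (\<Sum>m<n. x m * (c(l := \<lambda>i. c l i + t * c j i)) m i)" if "i < n" for i
    unfolding column_span_def by blast
  have rem: "(\<Sum>m<n. f m) = f l + (f j + (\<Sum>m\<in>{..<n} - {l} - {j}. f m))" for f :: "nat \<Rightarrow> int"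
    using assms by (simp add: sum.remove[of "{..<n}" l] sum.remove[of "{..<n} - {l}" j])
  have "v i = (\<Sum>m<n. (x(j := x j + t * x l)) m * c m i)" if "i < n" for i
    unfolding x[OF that] rem using assms by (auto simp: algebra_simps intro: sum.cong)
  then show "v \<in> column_span n c"
    unfolding column_span_def by blast
qed

lemma column_span_swap:
  assumes "j < n" "l < n"
  shows "column_span n (c(j := c l, l := c j)) \<subseteq> column_span n c"
proof
  fix v assume "v \<in> column_span n (c(j := c l, l := c j))"
  then obtain x where x: "v i = (\<Sum>m<n. x m * (c(j := c l, l := c j)) m i)" if "i < n" for i
    unfolding column_span_def by blast
  have "v i = (\<Sum>m<n. x (Transposition.transpose j l m) * c m i)" if "i < n" for i
    unfolding x[OF that] using assms
    by (intro sum.reindex_bij_witness[of _ "Transposition.transpose j l" "Transposition.transpose j l"]) (auto simp: Transposition.transpose_def)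
  then show "v \<in> column_span n c"
    unfolding column_span_def by (auto intro!: exI[of _ "\<lambda>m. x (Transposition.transpose j l m)"])
qed

lemma column_span_add_column_eq:
  assumes "j < n" "l < n" "j \<noteq> l"
  shows "column_span n (c(l := \<lambda>i. c l i + t * c j i)) = column_span n c"
proof
  let ?c = "c(l := \<lambda>i. c l i + t * c j i)"
  have "?c(l := \<lambda>i. ?c l i + (- t) * ?c j i) = c"
    using assms by auto
  then show "column_span n c \<subseteq> column_span n ?c"
    using column_span_add_column[OF assms, of ?c "- t"] by simp
qed (rule column_span_add_column[OF assms])

lemma column_span_swap_eq:
  assumes "j < n" "l < n"
  shows "column_span n (c(j := c l, l := c j)) = column_span n c"
proof
  let ?c = "c(j := c l, l := c j)"
  have "?c(j := ?c l, l := ?c j) = c" by auto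
  then show "column_span n c \<subseteq> column_span n ?c"
    using column_span_swap[OF assms, of ?c] by simp
qed (rule column_span_swap[OF assms])

text \<open>With last row \<open>(0, ..., 0, c n n)\<close> the determinant factors. A vector is
  reduced first in its last coordinate modulo \<open>c n n\<close>, using column \<open>n\<close>,
  and then in the others by residues of the smaller matrix. The induction hypothesis is an
  assumption because the calling induction arrives here both directly and after a column
  swap.\<close>

lemma residues_mod_last_row:
  assumes row: "\<And>j. j < n \<Longrightarrow> c j n = 0"
    and full: "\<And>v. \<exists>k. k \<noteq> 0 \<and> (\<lambda>i. k * v i) \<in> column_span (Suc n) c"
    and IH: "\<And>c. (\<And>v. \<exists>k. k \<noteq> 0 \<and> (\<lambda>i. k * v i) \<in> column_span n c) \<Longrightarrow>
      \<exists>R. finite R \<and> int (card R) \<le> \<bar>cdet n c\<bar> \<and> (\<forall>v. \<exists>r\<in>R. (\<lambda>i. v i - r i) \<in> column_span n c)"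
  shows "\<exists>R. finite R \<and> int (card R) \<le> \<bar>cdet (Suc n) c\<bar> \<and>
    (\<forall>v. \<exists>r\<in>R. (\<lambda>i. v i - r i) \<in> column_span (Suc n) c)"
proof -
  have last: "(\<Sum>j<Suc n. x j * c j n) = x n * c n n" for x
    using row by simp
  have cdet: "cdet (Suc n) c = c n n * cdet n c"
    using row by simp
  \<comment> \<open>A nonzero multiple of the last unit vector lies in the span, which forces the
    diagonal entry to be nonzero.\<close>
  obtain k x where "k \<noteq> 0" and x: "\<And>i. i < Suc n \<Longrightarrow> k * (if i = n then 1 else 0) = (\<Sum>j<Suc n. x j * c j i)"
    using full[of "\<lambda>i. if i = n then 1 else 0"] unfolding column_span_def by auto
  then have nz: "c n n \<noteq> 0"
    using x[of n] last[of x] by auto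
  have "\<exists>k. k \<noteq> 0 \<and> (\<lambda>i. k * v i) \<in> column_span n c" for v
  proof -
    \<comment> \<open>With last coordinate \<open>0\<close>, column \<open>n\<close> must occur with
      coefficient \<open>0\<close>, so the rank condition descends to the smaller matrix.\<close>
    obtain k x where k: "k \<noteq> 0" and x: "\<And>i. i < Suc n \<Longrightarrow> k * (v(n := 0)) i = (\<Sum>j<Suc n. x j * c j i)"
      using full[of "v(n := 0)"] unfolding column_span_def by auto
    have "x n = 0" using x[of n] last[of x] nz by simp
    then have "k * v i = (\<Sum>j<n. x j * c j i)" if "i < n" for i
      using x[of i] that by simp
    then show ?thesis using k unfolding column_span_def by blast
  qed
  then obtain R where R: "finite R" "int (card R) \<le> \<bar>cdet n c\<bar>"
    and cover: "\<And>v. \<exists>r\<in>R. (\<lambda>i. v i - r i) \<in> column_span n c"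
    using IH by meson
  let ?R = "(\<lambda>(a, r). r(n := a)) ` ({0..<\<bar>c n n\<bar>} \<times> R)"
  have "card ?R \<le> card ({0..<\<bar>c n n\<bar>} \<times> R)"
    by (intro card_image_le) (use R in auto)
  then have "int (card ?R) \<le> int (card ({0..<\<bar>c n n\<bar>} \<times> R))" by simp
  also have "\<dots> = \<bar>c n n\<bar> * int (card R)"
    by (simp add: card_cartesian_product)
  also have "\<dots> \<le> \<bar>cdet (Suc n) c\<bar>"
    unfolding cdet abs_mult using R by (intro mult_left_mono) auto
  finally have "int (card ?R) \<le> \<bar>cdet (Suc n) c\<bar>" .
  moreover have "\<exists>r\<in>?R. (\<lambda>i. v i - r i) \<in> column_span (Suc n) c" for v
  proof -
    define a where "a = v n mod \<bar>c n n\<bar>"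
    have "c n n dvd v n - a"
      unfolding a_def by (metis abs_dvd_iff dvd_minus_mod)
    then obtain q where q: "v n - a = c n n * q" by (elim dvdE)
    obtain r where r: "r \<in> R" "(\<lambda>i. (v i - q * c n i) - r i) \<in> column_span n c"
      using cover[of "\<lambda>i. v i - q * c n i"] by blast
    then obtain x where x: "\<And>i. i < n \<Longrightarrow> v i - q * c n i - r i = (\<Sum>j<n. x j * c j i)"
      unfolding column_span_def by auto
    have "v i - (r(n := a)) i = (\<Sum>j<Suc n. (x(n := q)) j * c j i)" if "i < Suc n" for i
    proof (cases "i = n")
      case True
      then show ?thesis using q row by (simp add: algebra_simps)
    next
      case False
      then show ?thesis using x[of i] that by simp
    qed
    then have "(\<lambda>i. v i - (r(n := a)) i) \<in> column_span (Suc n) c"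
      unfolding column_span_def by blast
    moreover have "r(n := a) \<in> ?R"
      using r(1) nz by (intro image_eqI[of _ _ "(a, r)"]) (auto simp: a_def)
    ultimately show ?thesis by blast
  qed
  ultimately show ?thesis using R(1) by (intro exI[of _ ?R]) auto
qed

text \<open>Euclid's algorithm on the last row makes it vanish outside the diagonal.\<close>

lemma card_residues_le_cdet:
  assumes "\<And>v. \<exists>k. k \<noteq> 0 \<and> (\<lambda>i. k * v i) \<in> column_span n c"
  shows "\<exists>R. finite R \<and> int (card R) \<le> \<bar>cdet n c\<bar> \<and> (\<forall>v. \<exists>r\<in>R. (\<lambda>i. v i - r i) \<in> column_span n c)"
  using assms
proof (induction n arbitrary: c)
  case 0
  then show ?case by (intro exI[of _ "{\<lambda>_. 0}"]) (auto simp: column_span_def)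
next
  case (Suc n)
  show ?case using Suc.prems
  \<comment> \<open>The inner induction is on the sum of the absolute values in the last
    row.\<close>
  proof (induction "nat (\<Sum>j<Suc n. \<bar>c j n\<bar>)" arbitrary: c rule: less_induct)
    case less
    show ?case
    proof (cases "\<exists>j l. j < Suc n \<and> l < Suc n \<and> j \<noteq> l \<and> c j n \<noteq> 0 \<and> c l n \<noteq> 0")
      case True
      then obtain j l where jl: "j < Suc n" "l < Suc n" "j \<noteq> l" "c j n \<noteq> 0" "\<bar>c j n\<bar> \<le> \<bar>c l n\<bar>"
        by (metis linorder_linear abs_zero abs_le_zero_iff)
      \<comment> \<open>With this sign the entry of larger absolute value becomes smaller by exactly
        \<open>\<bar>c j n\<bar>\<close>: a subtractive Euclidean step.\<close>
      define t where "t = - sgn (c l n) * sgn (c j n)"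
      let ?c = "c(l := \<lambda>i. c l i + t * c j i)"
      have dec: "\<bar>?c l n\<bar> < \<bar>c l n\<bar>"
        using jl unfolding t_def by (auto simp: sgn_if)
      have "(\<Sum>m<Suc n. \<bar>?c m n\<bar>) = \<bar>?c l n\<bar> + (\<Sum>m\<in>{..<Suc n} - {l}. \<bar>?c m n\<bar>)"
        using jl by (intro sum.remove) auto
      also have "\<dots> < \<bar>c l n\<bar> + (\<Sum>m\<in>{..<Suc n} - {l}. \<bar>c m n\<bar>)"
        using dec by simp
      also have "\<dots> = (\<Sum>m<Suc n. \<bar>c m n\<bar>)"
        using jl by (intro sum.remove[symmetric]) auto
      finally have "nat (\<Sum>m<Suc n. \<bar>?c m n\<bar>) < nat (\<Sum>m<Suc n. \<bar>c m n\<bar>)"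
        by (subst nat_less_eq_zless) (auto intro: sum_nonneg)
      then show ?thesis
        using less.hyps[of ?c] less.prems
        unfolding column_span_add_column_eq[OF jl(1-3)] cdet_add_column[OF jl(1-3)] by blast
    next
      case one_nonzero: False
      show ?thesis
      proof (cases "\<forall>j<n. c j n = 0")
        case True
        then show ?thesis
          by (intro residues_mod_last_row[OF _ less.prems Suc.IH]) auto
      next
        case False
        then obtain j where j: "j < n" "c j n \<noteq> 0" by auto
        \<comment> \<open>The only nonzero entry of the last row is moved to the diagonal.\<close>
        let ?c = "c(j := c n, n := c j)"
        have zero: "?c m n = 0" if "m < n" for m
        proof (cases "m = j")
          case True
          have "c n n = 0"
            using one_nonzero j by (metis less_SucI lessI less_irrefl)
          then show ?thesis using True j by simp
        next
          case False
          then have "c m n = 0"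
            using one_nonzero j that by (metis less_SucI)
          then show ?thesis using False that by simp
        qed
        have jn: "j < Suc n" "n < Suc n" "j \<noteq> n" using j by auto
        have "\<exists>R. finite R \<and> int (card R) \<le> \<bar>cdet (Suc n) ?c\<bar> \<and>
            (\<forall>v. \<exists>r\<in>R. (\<lambda>i. v i - r i) \<in> column_span (Suc n) ?c)"
        proof (rule residues_mod_last_row[of n ?c, OF zero])
          show "\<exists>k. k \<noteq> 0 \<and> (\<lambda>i. k * v i) \<in> column_span (Suc n) ?c" for v
            unfolding column_span_swap_eq[OF jn(1,2)] by (rule less.prems)
        qed (auto intro: Suc.IH)
        then show ?thesis
          unfolding column_span_swap_eq[OF jn(1,2)] cdet_swap[OF jn] abs_minus_cancel .
      qed
    qed
  qed
qed

subsection \<open>Sampling vertices\<close>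

lemma sum_lists_Suc:
  "(\<Sum>xs | set xs \<subseteq> V \<and> length xs = Suc k. f xs)
    = (\<Sum>x\<in>V. \<Sum>xs | set xs \<subseteq> V \<and> length xs = k. f (x # xs))"
proof -
  have "(\<Sum>xs | set xs \<subseteq> V \<and> length xs = Suc k. f xs)
      = (\<Sum>(x, xs)\<in>V \<times> {xs. set xs \<subseteq> V \<and> length xs = k}. f (x # xs))"
    by (rule sum.reindex_bij_witness[of _ "\<lambda>(x, xs). x # xs" "\<lambda>xs. (hd xs, tl xs)"])
      (auto simp: length_Suc_conv)
  then show ?thesis by (simp add: sum.cartesian_product)
qed

text \<open>The sum is split according to whether the first draw hits \<open>D\<close>.\<close>

lemma sum_lists_count_Suc:
  fixes g :: "nat \<Rightarrow> real"
  assumes "finite V" "D \<subseteq> V"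
  shows "(\<Sum>xs | set xs \<subseteq> V \<and> length xs = Suc k. g (length (filter (\<lambda>x. x \<in> D) xs)))
    = real (card D) * (\<Sum>xs | set xs \<subseteq> V \<and> length xs = k. g (Suc (length (filter (\<lambda>x. x \<in> D) xs))))
      + real (card (V - D)) * (\<Sum>xs | set xs \<subseteq> V \<and> length xs = k. g (length (filter (\<lambda>x. x \<in> D) xs)))"
proof -
  have "V = D \<union> (V - D)" using assms by auto
  then have *: "(\<Sum>x\<in>V. f x) = (\<Sum>x\<in>D. f x) + (\<Sum>x\<in>V - D. f x)" for f :: "_ \<Rightarrow> real"
    using assms by (metis sum.subset_diff add.commute)
  show ?thesis
    unfolding sum_lists_Suc by (simp add: *)
qed

text \<open>Size-biasing of the binomial distribution: the factor \<open>X xs\<close> marks one draw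
  that hits \<open>D\<close>. There are \<open>Suc k\<close> positions and \<open>card D\<close>
  values for it, and deleting it leaves a list of length \<open>k\<close> with one hit less.\<close>

lemma sum_lists_size_biased:
  fixes h :: "nat \<Rightarrow> real"
  assumes "finite V" "D \<subseteq> V"
  defines "X \<equiv> \<lambda>xs. length (filter (\<lambda>x. x \<in> D) xs)"
  shows "(\<Sum>xs | set xs \<subseteq> V \<and> length xs = Suc k. real (X xs) * h (X xs))
    = real (Suc k) * real (card D) * (\<Sum>xs | set xs \<subseteq> V \<and> length xs = k. h (Suc (X xs)))"
proof (induction k arbitrary: h)
  case 0
  show ?case
    using sum_lists_count_Suc[OF assms(1,2), of "\<lambda>j. real j * h j" 0] by (simp add: X_def)
next
  case (Suc k)
  let ?L = "\<lambda>k. {xs. set xs \<subseteq> V \<and> length xs = k}"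
  note rec = sum_lists_count_Suc[OF assms(1,2)]
  have "(\<Sum>xs\<in>?L (Suc (Suc k)). real (X xs) * h (X xs))
      = card D * (\<Sum>xs\<in>?L (Suc k). h (Suc (X xs)))
        + card D * (\<Sum>xs\<in>?L (Suc k). real (X xs) * h (Suc (X xs)))
        + card (V - D) * (\<Sum>xs\<in>?L (Suc k). real (X xs) * h (X xs))"
    using rec[of "\<lambda>j. real j * h j" "Suc k"]
    by (simp add: X_def algebra_simps sum.distrib)
  also have "\<dots> = card D * (\<Sum>xs\<in>?L (Suc k). h (Suc (X xs)))
      + real (Suc k) * card D * (card D * (\<Sum>xs\<in>?L k. h (Suc (Suc (X xs))))
        + card (V - D) * (\<Sum>xs\<in>?L k. h (Suc (X xs))))"
    using Suc.IH[of h] Suc.IH[of "\<lambda>j. h (Suc j)"] by (simp add: algebra_simps)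
  also have "card D * (\<Sum>xs\<in>?L k. h (Suc (Suc (X xs)))) + card (V - D) * (\<Sum>xs\<in>?L k. h (Suc (X xs)))
      = (\<Sum>xs\<in>?L (Suc k). h (Suc (X xs)))"
    using rec[of "\<lambda>j. h (Suc j)" k] by (simp add: X_def)
  finally show ?case by (simp add: algebra_simps)
qed

text \<open>This bounds the mean of the inverse of the smoothed count, by size-biasing with
  \<open>h j = 1 / j\<close>.\<close>

lemma sum_lists_inverse_count_le:
  assumes "finite V" "D \<subseteq> V"
  shows "real (Suc k) * real (card D) *
      (\<Sum>xs | set xs \<subseteq> V \<and> length xs = k. 1 / real (Suc (length (filter (\<lambda>x. x \<in> D) xs))))
    \<le> real (card V) ^ Suc k"
proof -
  let ?X = "\<lambda>xs. length (filter (\<lambda>x. x \<in> D) xs)"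
  have "real (Suc k) * real (card D) * (\<Sum>xs | set xs \<subseteq> V \<and> length xs = k. 1 / real (Suc (?X xs)))
      = (\<Sum>xs | set xs \<subseteq> V \<and> length xs = Suc k. real (?X xs) * (1 / real (?X xs)))"
    by (rule sum_lists_size_biased[OF assms, symmetric])
  \<comment> \<open>Each term is \<open>1\<close>, except that it is \<open>0\<close> when the count
    is \<open>0\<close>, since \<open>1 / 0 = 0\<close>.\<close>
  also have "\<dots> \<le> (\<Sum>xs | set xs \<subseteq> V \<and> length xs = Suc k. 1)"
    by (rule sum_mono) simp
  also have "\<dots> = real (card V) ^ Suc k"
    using card_lists_length_eq[OF assms(1), of "Suc k"] by simp
  finally show ?thesis .
qed

text \<open>The logarithm of the quotient of the two sides has nonpositive mean over a uniformly random
  sample \<open>xs\<close>, by \<open>ln x \<le> x - 1\<close> and the previous bound. Adding \<open>1\<close> to the count keeps the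
  quotient bounded in mean even if the density of \<open>D e\<close> is tiny.\<close>

lemma exists_sample_prod_density_le:
  assumes V: "finite V" "V \<noteq> {}" and I: "finite I" and D: "\<And>e. e \<in> I \<Longrightarrow> D e \<subseteq> V"
  shows "\<exists>xs. set xs \<subseteq> V \<and> length xs = k \<and>
    (\<Prod>e\<in>I. real (card (D e)) / real (card V))
      \<le> (\<Prod>e\<in>I. real (Suc (length (filter (\<lambda>x. x \<in> D e) xs))) / real (Suc k))"
proof (cases "\<exists>e\<in>I. D e = {}")
  \<comment> \<open>The logarithms below need nonempty \<open>D e\<close>. Otherwise the left side
    vanishes and any sample of length \<open>k\<close> will do.\<close>
  case True
  then have "(\<Prod>e\<in>I. real (card (D e)) / real (card V)) = 0"
    using I by (auto intro!: prod_zero bexI)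
  moreover obtain x where "x \<in> V" using V by auto
  ultimately show ?thesis
    by (intro exI[of _ "replicate k x"]) (auto intro: prod_nonneg)
next
  case False
  let ?L = "{xs. set xs \<subseteq> V \<and> length xs = k}"
  \<comment> \<open>The quotient of the factors at \<open>e\<close> on the two sides.\<close>
  define r where "r xs e = real (card (D e)) * real (Suc k) /
      (real (card V) * real (Suc (length (filter (\<lambda>x. x \<in> D e) xs))))" for xs e
  have fin: "finite ?L" using finite_lists_length_eq[OF V(1)] .
  have "card ?L = card V ^ k" using card_lists_length_eq[OF V(1)] .
  have cV: "card V > 0" using V by (simp add: card_gt_0_iff)
  have pos: "r xs e > 0" if "e \<in> I" for xs e
    using that False D[OF that] V cV finite_subset[OF D[OF that]]
    unfolding r_def by (auto intro!: divide_pos_pos mult_pos_pos simp: card_gt_0_iff)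
  have mean: "(\<Sum>xs\<in>?L. r xs e) \<le> real (card V) ^ k" if "e \<in> I" for e
  proof -
    have "(\<Sum>xs\<in>?L. r xs e) = real (Suc k) * real (card (D e)) *
        (\<Sum>xs\<in>?L. 1 / real (Suc (length (filter (\<lambda>x. x \<in> D e) xs)))) / real (card V)"
      unfolding r_def sum_distrib_left sum_divide_distrib
      by (intro sum.cong) (auto simp: field_simps)
    also have "\<dots> \<le> real (card V) ^ Suc k / real (card V)"
      by (intro divide_right_mono sum_lists_inverse_count_le V D that) simp
    finally show ?thesis using cV by simp
  qed
  have "(\<Sum>xs\<in>?L. \<Sum>e\<in>I. ln (r xs e)) \<le> (\<Sum>xs\<in>?L. \<Sum>e\<in>I. r xs e - 1)"
    by (intro sum_mono ln_le_minus_one pos)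
  also have "\<dots> = (\<Sum>e\<in>I. (\<Sum>xs\<in>?L. r xs e) - real (card V) ^ k)"
    by (subst sum.swap) (simp add: sum_subtractf \<open>card ?L = card V ^ k\<close>)
  also have "\<dots> \<le> 0"
    by (intro sum_nonpos) (use mean in auto)
  finally have le0: "(\<Sum>xs\<in>?L. \<Sum>e\<in>I. ln (r xs e)) \<le> 0" .
  have "?L \<noteq> {}"
    using V fin \<open>card ?L = card V ^ k\<close> cV by (metis card.empty power_not_zero less_irrefl)
  \<comment> \<open>If all the inner sums were positive, so would be their total over the nonempty
    set of samples.\<close>
  with le0 obtain xs where xs: "xs \<in> ?L" "(\<Sum>e\<in>I. ln (r xs e)) \<le> 0"
    using sum_pos[OF fin, of "\<lambda>xs. \<Sum>e\<in>I. ln (r xs e)"] by (meson not_le)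
  have "ln (\<Prod>e\<in>I. r xs e) \<le> 0"
    using xs pos by (subst ln_prod[OF I]) (auto simp: less_imp_neq[symmetric])
  then have "(\<Prod>e\<in>I. r xs e) \<le> 1"
    using pos by (simp add: prod_pos)
  moreover have "r xs e = (real (card (D e)) / real (card V)) /
      (real (Suc (length (filter (\<lambda>x. x \<in> D e) xs))) / real (Suc k))" for e
    by (simp add: r_def)
  ultimately have "(\<Prod>e\<in>I. real (card (D e)) / real (card V)) /
      (\<Prod>e\<in>I. real (Suc (length (filter (\<lambda>x. x \<in> D e) xs))) / real (Suc k)) \<le> 1"
    by (simp only: prod_dividef)
  moreover have "(\<Prod>e\<in>I. real (Suc (length (filter (\<lambda>x. x \<in> D e) xs))) / real (Suc k)) > 0"
    by (intro prod_pos) simp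
  ultimately show ?thesis
    using xs(1) by (intro exI[of _ xs]) (simp only: divide_le_eq_1_pos mem_Collect_eq simp_thms)
qed

section \<open>Summation over all labellings of the edges\<close>

text \<open>Once the values on \<open>E\<^sub>0\<close> are fixed, each factor outside
  \<open>E\<^sub>0\<close> depends only on the label of its own edge. The sum over the remaining
  labels is then a product of sums that are at most \<open>1\<close>. Factors inside
  \<open>E\<^sub>0\<close> are bounded by \<open>1\<close>, and \<open>E\<^sub>0\<close> contributes
  the number of its labellings.\<close>

lemma sum_PiE_prod_le:
  fixes Q :: "'e \<Rightarrow> ('e \<Rightarrow> 'g) \<Rightarrow> real"
  assumes fin: "finite E" "finite X" and sub: "E\<^sub>0 \<subseteq> E" "F \<subseteq> E" "E - E\<^sub>0 \<subseteq> F"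
    and Q: "\<And>h e. h \<in> E \<rightarrow>\<^sub>E X \<Longrightarrow> e \<in> F \<Longrightarrow> 0 \<le> Q e h \<and> Q e h \<le> 1"
    and QR: "\<And>h e. h \<in> E \<rightarrow>\<^sub>E X \<Longrightarrow> e \<in> E - E\<^sub>0 \<Longrightarrow> Q e h = R e (restrict h E\<^sub>0) (h e)"
    and R: "\<And>a e g. 0 \<le> R e a g"
    and R_sum: "\<And>a e. e \<in> E - E\<^sub>0 \<Longrightarrow> (\<Sum>g\<in>X. R e a g) \<le> 1"
  shows "(\<Sum>h\<in>E \<rightarrow>\<^sub>E X. \<Prod>e\<in>F. Q e h) \<le> real (card X) ^ card E\<^sub>0"
proof -
  let ?E = "E - E\<^sub>0"
  have finE: "finite ?E" "finite E\<^sub>0" "finite F"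
    using fin sub finite_subset by auto
  let ?split = "\<lambda>h. (restrict h E\<^sub>0, restrict h ?E)"
  let ?G = "\<lambda>(a, b). \<Prod>e\<in>?E. R e a (b e)"
  have inj: "inj_on ?split (E \<rightarrow>\<^sub>E X)"
  proof (rule inj_onI)
    fix h h' assume h: "h \<in> E \<rightarrow>\<^sub>E X" "h' \<in> E \<rightarrow>\<^sub>E X" "?split h = ?split h'"
    show "h = h'"
    proof (rule PiE_ext[OF h(1,2)])
      fix e assume "e \<in> E"
      then show "h e = h' e"
        using h(3) by (cases "e \<in> E\<^sub>0") (auto dest!: fun_cong[of _ _ e])
    qed
  qed
  have "(\<Prod>e\<in>F. Q e h) \<le> ?G (?split h)" if h: "h \<in> E \<rightarrow>\<^sub>E X" for h
  proof -
    have "(\<Prod>e\<in>F. Q e h) = (\<Prod>e\<in>F - ?E. Q e h) * (\<Prod>e\<in>?E. Q e h)"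
      using sub finE by (intro prod.subset_diff) auto
    also have "\<dots> \<le> 1 * (\<Prod>e\<in>?E. Q e h)"
      using Q[OF h] sub by (intro mult_right_mono prod_le_1 prod_nonneg) auto
    also have "\<dots> = ?G (?split h)"
      using QR[OF h] by simp
    finally show ?thesis .
  qed
  then have "(\<Sum>h\<in>E \<rightarrow>\<^sub>E X. \<Prod>e\<in>F. Q e h) \<le> (\<Sum>h\<in>E \<rightarrow>\<^sub>E X. ?G (?split h))"
    by (rule sum_mono)
  also have "\<dots> = (\<Sum>p\<in>?split ` (E \<rightarrow>\<^sub>E X). ?G p)"
    by (simp add: sum.reindex[OF inj])
  \<comment> \<open>All terms are nonnegative, so passing to the whole product set can only increase
    the sum.\<close>
  also have "\<dots> \<le> (\<Sum>p\<in>(E\<^sub>0 \<rightarrow>\<^sub>E X) \<times> (?E \<rightarrow>\<^sub>E X). ?G p)"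
    using fin finE sub by (intro sum_mono2) (auto intro!: finite_PiE prod_nonneg R)
  also have "\<dots> = (\<Sum>a\<in>E\<^sub>0 \<rightarrow>\<^sub>E X. \<Sum>b\<in>?E \<rightarrow>\<^sub>E X. \<Prod>e\<in>?E. R e a (b e))"
    by (simp add: sum.cartesian_product)
  also have "\<dots> = (\<Sum>a\<in>E\<^sub>0 \<rightarrow>\<^sub>E X. \<Prod>e\<in>?E. \<Sum>g\<in>X. R e a g)"
    using fin finE by (simp add: prod_sum_PiE)
  also have "\<dots> \<le> (\<Sum>a\<in>E\<^sub>0 \<rightarrow>\<^sub>E X. 1)"
    by (intro sum_mono prod_le_1) (auto intro!: sum_nonneg R R_sum)
  also have "\<dots> = real (card X) ^ card E\<^sub>0"
    using finE by (simp add: card_PiE)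
  finally show ?thesis .
qed

text \<open>Each entry \<open>w\<close> is counted at most once, namely for \<open>g = f w\<close>,
  and only if that value lies in \<open>X\<close>.\<close>

lemma sum_length_filter_eq_le:
  "finite X \<Longrightarrow> (\<Sum>g\<in>X. length (filter (\<lambda>w. f w = g) xs)) \<le> length xs"
proof (induction xs)
  case (Cons w xs)
  have "(\<Sum>g\<in>X. length (filter (\<lambda>w. f w = g) (w # xs)))
      = (\<Sum>g\<in>X. (if f w = g then 1 else 0) + length (filter (\<lambda>w. f w = g) xs))"
    by (intro sum.cong) auto
  also have "\<dots> = (\<Sum>g\<in>X. if f w = g then 1 else 0) + (\<Sum>g\<in>X. length (filter (\<lambda>w. f w = g) xs))"
    by (rule sum.distrib)
  also have "\<dots> \<le> 1 + length xs"
    using Cons by (intro add_mono) auto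
  finally show ?case by simp
qed simp

definition edge_pairs :: "nat \<Rightarrow> (nat \<times> nat) set" where
  "edge_pairs n = {(u, v). 1 \<le> u \<and> u < v \<and> v \<le> n}"

text \<open>The edges outside the star at the vertex \<open>1\<close>, a spanning tree. Their number
  is that of the triangles of a hypertree, so the boundary matrix with these rows is square.\<close>

definition reduced_pairs :: "nat \<Rightarrow> (nat \<times> nat) set" where
  "reduced_pairs n = {(u, v). 2 \<le> u \<and> u < v \<and> v \<le> n}"

definition alternating_ext :: "('g, 'm) monoid_scheme \<Rightarrow> (nat \<times> nat \<Rightarrow> 'g) \<Rightarrow> nat \<Rightarrow> nat \<Rightarrow> 'g" where
  "alternating_ext G h u v = (if u < v then h (u, v) else inv\<^bsub>G\<^esub> h (v, u))"

text \<open>The condition is solved for \<open>h e\<close>, wherever \<open>w\<close> lies relative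
  to the edge, so that \<open>w\<close> predicts one value for the label of
  \<open>e\<close>.\<close>

definition closing_vertices ::
    "nat \<Rightarrow> ('g, 'm) monoid_scheme \<Rightarrow> (nat \<times> nat \<Rightarrow> 'g) \<Rightarrow> nat \<times> nat \<Rightarrow> nat set" where
  "closing_vertices n G h e = {w \<in> {1..n} - {fst e, snd e}.
     alternating_ext G h (fst e) w \<otimes>\<^bsub>G\<^esub> alternating_ext G h w (snd e) = h e}"

lemma closing_vertices_subset: "closing_vertices n G h e \<subseteq> {1..n}"
  by (auto simp: closing_vertices_def)

lemma finite_edge_pairs: "finite (edge_pairs n)"
  by (rule finite_subset[of _ "{1..n} \<times> {1..n}"]) (auto simp: edge_pairs_def)

lemma reduced_pairs_subset: "reduced_pairs n \<subseteq> edge_pairs n"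
  by (auto simp: reduced_pairs_def edge_pairs_def)

lemma card_reduced_pairs: "card (reduced_pairs n) = (n - 1) choose 2"
proof -
  have "bij_betw (\<lambda>(u, v). {u, v}) (reduced_pairs n) {K. K \<subseteq> {2..n} \<and> card K = 2}"
    unfolding bij_betw_def
  proof
    show "inj_on (\<lambda>(u, v). {u, v}) (reduced_pairs n)"
      by (auto simp: inj_on_def reduced_pairs_def doubleton_eq_iff)
    show "(\<lambda>(u, v). {u, v}) ` reduced_pairs n = {K. K \<subseteq> {2..n} \<and> card K = 2}"
    proof (intro equalityI subsetI)
      fix K assume "K \<in> {K. K \<subseteq> {2..n} \<and> card K = 2}"
      then obtain u v where "K = {u, v}" "u < v" "u \<in> {2..n}" "v \<in> {2..n}"
        by (auto simp: card_2_iff) (metis insert_commute linorder_neqE_nat)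
      then show "K \<in> (\<lambda>(u, v). {u, v}) ` reduced_pairs n"
        by (intro image_eqI[of _ _ "(u, v)"]) (auto simp: reduced_pairs_def)
    qed (auto simp: reduced_pairs_def)
  qed
  then have "card (reduced_pairs n) = card {K. K \<subseteq> {2..n} \<and> card K = 2}"
    by (rule bij_betw_same_card)
  then show ?thesis
    by (simp add: n_subsets)
qed

text \<open>Once the values of \<open>h\<close> on the edges meeting the sample \<open>xs\<close> or the vertex \<open>1\<close> are fixed, the smoothed
  empirical densities form for each other edge a subprobability distribution of its value, so the
  product sums to at most \<open>1\<close> over all extensions.\<close>

lemma sum_prod_closing_vertices_le:
  fixes G :: "('g, 'm) monoid_scheme"
  assumes "finite (carrier G)" "carrier G \<noteq> {}" "n > 0"
  defines "m \<equiv> real (card (carrier G))"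
  shows "(\<Sum>h\<in>edge_pairs n \<rightarrow>\<^sub>E carrier G. \<Prod>e\<in>reduced_pairs n. real (card (closing_vertices n G h e)) / real n)
    \<le> real n ^ k * ((real k + m) / real (Suc k)) ^ ((n - 1) choose 2) * m ^ ((2 * k + 1) * n)"
proof -
  let ?P = "edge_pairs n" and ?F = "reduced_pairs n" and ?X = "carrier G"
  let ?L = "{xs. set xs \<subseteq> {1..n} \<and> length xs = k}"
  define c where "c h e xs = length (filter (\<lambda>w. w \<in> closing_vertices n G h e) xs)" for h e xs
  have m: "m \<ge> 1"
    using assms by (simp add: m_def Suc_le_eq card_gt_0_iff)
  have finF: "finite ?F" using finite_subset[OF reduced_pairs_subset finite_edge_pairs] .
  have finL: "finite ?L" by (rule finite_lists_length_eq) simp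
  have sample: "(\<Sum>h\<in>?P \<rightarrow>\<^sub>E ?X. \<Prod>e\<in>?F. real (Suc (c h e xs)) / (real k + m)) \<le> m ^ ((2 * k + 1) * n)"
    if xs: "xs \<in> ?L" for xs
  proof -
    \<comment> \<open>The star at \<open>1\<close> is included because
      \<open>reduced_pairs n\<close> misses it, so that every edge outside \<open>E\<^sub>0\<close>
      has a factor in the product.\<close>
    define E\<^sub>0 where "E\<^sub>0 = {(u, v) \<in> ?P. u = 1 \<or> u \<in> set xs \<or> v \<in> set xs}"
    \<comment> \<open>Each of the \<open>m\<close> possible labels receives one extra count, which
      is why \<open>k + m\<close> normalizes to total mass at most \<open>1\<close>.\<close>
    define R where "R e a g = real (Suc (length (filter (\<lambda>w.
        alternating_ext G a (fst e) w \<otimes>\<^bsub>G\<^esub> alternating_ext G a w (snd e) = g) xs))) / (real k + m)"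
      for e a g
    have "(\<Sum>h\<in>?P \<rightarrow>\<^sub>E ?X. \<Prod>e\<in>?F. real (Suc (c h e xs)) / (real k + m)) \<le> real (card ?X) ^ card E\<^sub>0"
    proof (rule sum_PiE_prod_le[where R = R])
      show "E\<^sub>0 \<subseteq> ?P" "?P - E\<^sub>0 \<subseteq> ?F"
        by (auto simp: E\<^sub>0_def edge_pairs_def reduced_pairs_def)
      show "0 \<le> R e a g" for e a g using m by (simp add: R_def)
      show "0 \<le> real (Suc (c h e xs)) / (real k + m) \<and> real (Suc (c h e xs)) / (real k + m) \<le> 1" for h e
      proof -
        have "c h e xs \<le> k" using xs length_filter_le[of _ xs] by (auto simp: c_def)
        then show ?thesis using m by (auto simp: divide_le_eq)
      qed
      show "(\<Sum>g\<in>?X. R e a g) \<le> 1" for e a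
      proof -
        define l where "l g = length (filter (\<lambda>w.
            alternating_ext G a (fst e) w \<otimes>\<^bsub>G\<^esub> alternating_ext G a w (snd e) = g) xs)" for g
        have "(\<Sum>g\<in>?X. l g) \<le> k"
          using sum_length_filter_eq_le[OF assms(1), of _ xs] xs by (auto simp: l_def)
        then have "real (\<Sum>g\<in>?X. l g) \<le> real k" by (rule of_nat_mono)
        moreover have "(\<Sum>g\<in>?X. R e a g) = (m + real (\<Sum>g\<in>?X. l g)) / (real k + m)"
          by (simp add: R_def l_def[symmetric] sum_divide_distrib[symmetric] sum.distrib m_def)
        ultimately show ?thesis using m by (simp add: divide_le_eq)
      qed
      show "real (Suc (c h e xs)) / (real k + m) = R e (restrict h E\<^sub>0) (h e)"
        if "h \<in> ?P \<rightarrow>\<^sub>E ?X" and e: "e \<in> ?P - E\<^sub>0" for h e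
      proof -
        obtain u v where uv: "e = (u, v)" by (cases e)
        have "w \<in> closing_vertices n G h e \<longleftrightarrow> alternating_ext G (restrict h E\<^sub>0) (fst e) w
            \<otimes>\<^bsub>G\<^esub> alternating_ext G (restrict h E\<^sub>0) w (snd e) = h e" if w: "w \<in> set xs" for w
        proof -
          \<comment> \<open>Since \<open>e\<close> avoids the sample, \<open>w\<close> is a third
            vertex, and both edges joining it to \<open>e\<close> lie in
            \<open>E\<^sub>0\<close>.\<close>
          have "w \<in> {1..n}" "w \<noteq> u" "w \<noteq> v" "u \<in> {1..n}" "v \<in> {1..n}"
            using e xs w by (auto simp: uv E\<^sub>0_def edge_pairs_def)
          moreover from this have "alternating_ext G (restrict h E\<^sub>0) u w = alternating_ext G h u w"
            "alternating_ext G (restrict h E\<^sub>0) w v = alternating_ext G h w v"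
            using w by (auto simp: alternating_ext_def E\<^sub>0_def edge_pairs_def)
          ultimately show ?thesis
            by (simp add: closing_vertices_def uv)
        qed
        then have "filter (\<lambda>w. w \<in> closing_vertices n G h e) xs = filter (\<lambda>w.
            alternating_ext G (restrict h E\<^sub>0) (fst e) w \<otimes>\<^bsub>G\<^esub> alternating_ext G (restrict h E\<^sub>0) w (snd e) = h e) xs"
          by (intro filter_cong) auto
        then show ?thesis by (simp add: R_def c_def)
      qed
    qed (use assms finite_edge_pairs reduced_pairs_subset in auto)
    also have "\<dots> \<le> m ^ ((2 * k + 1) * n)"
    proof -
      let ?B = "{1} \<times> {1..n} \<union> (set xs \<times> {1..n} \<union> {1..n} \<times> set xs)"
      have "card E\<^sub>0 \<le> card ?B"
        by (intro card_mono) (auto simp: E\<^sub>0_def edge_pairs_def)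
      also have "\<dots> \<le> n + (card (set xs) * n + n * card (set xs))"
        by (intro order_trans[OF card_Un_le] add_mono) (auto simp: card_cartesian_product)
      also have "\<dots> \<le> n + (k * n + n * k)"
        using xs card_length[of xs] by (intro add_mono mult_mono) auto
      finally have "card E\<^sub>0 \<le> (2 * k + 1) * n" by (simp add: algebra_simps)
      then show ?thesis
        unfolding m_def[symmetric] using m by (intro power_increasing)
    qed
    finally show ?thesis .
  qed
  \<comment> \<open>The good sample depends on \<open>h\<close>. Summing over all samples removes
    this dependence at the cost of a factor \<open>n ^ k\<close>.\<close>
  have "(\<Sum>h\<in>?P \<rightarrow>\<^sub>E ?X. \<Prod>e\<in>?F. real (card (closing_vertices n G h e)) / real n)
      \<le> (\<Sum>h\<in>?P \<rightarrow>\<^sub>E ?X. \<Sum>xs\<in>?L. \<Prod>e\<in>?F. real (Suc (c h e xs)) / real (Suc k))"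
  proof (rule sum_mono)
    fix h
    obtain xs where xs: "xs \<in> ?L" and le: "(\<Prod>e\<in>?F. real (card (closing_vertices n G h e)) / real n)
        \<le> (\<Prod>e\<in>?F. real (Suc (c h e xs)) / real (Suc k))"
      using exists_sample_prod_density_le[of "{1..n}" ?F "closing_vertices n G h" k] finF \<open>n > 0\<close>
        closing_vertices_subset[of n G h]
      unfolding c_def by auto
    note le
    also have "\<dots> \<le> (\<Sum>xs\<in>?L. \<Prod>e\<in>?F. real (Suc (c h e xs)) / real (Suc k))"
      using xs finL by (intro member_le_sum prod_nonneg) auto
    finally show "(\<Prod>e\<in>?F. real (card (closing_vertices n G h e)) / real n)
        \<le> (\<Sum>xs\<in>?L. \<Prod>e\<in>?F. real (Suc (c h e xs)) / real (Suc k))" .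
  qed
  also have "\<dots> = (\<Sum>xs\<in>?L. ((real k + m) / real (Suc k)) ^ card ?F *
      (\<Sum>h\<in>?P \<rightarrow>\<^sub>E ?X. \<Prod>e\<in>?F. real (Suc (c h e xs)) / (real k + m)))"
  proof -
    \<comment> \<open>Changing the normalization from \<open>k + 1\<close> to \<open>k + m\<close>
      costs one factor per reduced edge.\<close>
    have "real (Suc j) / real (Suc k) = (real k + m) / real (Suc k) * (real (Suc j) / (real k + m))" for j
      using m by simp
    then show ?thesis
      by (subst sum.swap) (simp only: prod.distrib prod_constant sum_distrib_left)
  qed
  also have "\<dots> \<le> (\<Sum>xs\<in>?L. ((real k + m) / real (Suc k)) ^ card ?F * m ^ ((2 * k + 1) * n))"
    using m by (intro sum_mono mult_left_mono sample) auto
  also have "\<dots> = real n ^ k * ((real k + m) / real (Suc k)) ^ card ?F * m ^ ((2 * k + 1) * n)"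
    using card_lists_length_eq[of "{1..n}" k] by simp
  finally show ?thesis by (simp add: card_reduced_pairs)
qed

subsection \<open>Homology of hypertrees\<close>

lemma simplicial_boundary_diff:
  "simplicial_boundary k (a - b) = simplicial_boundary k a - simplicial_boundary k b"
  by (simp add: simplicial_boundary_def frag_extend_diff)

lemma simplicial_boundary_add:
  "simplicial_boundary k (a + b) = simplicial_boundary k a + simplicial_boundary k b"
  by (simp add: simplicial_boundary_def frag_extend_add)

lemma simplicial_boundary_zero: "simplicial_boundary k 0 = 0"
  by (simp add: simplicial_boundary_def)

lemma simplicial_boundary_cmul:
  "simplicial_boundary k (frag_cmul x a) = frag_cmul x (simplicial_boundary k a)"
  by (simp add: simplicial_boundary_def frag_extend_cmul)

lemma simplicial_boundary_sum:
  "finite I \<Longrightarrow> simplicial_boundary k (\<Sum>i\<in>I. f i) = (\<Sum>i\<in>I. simplicial_boundary k (f i))"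
  by (simp add: simplicial_boundary_def frag_extend_sum o_def)

lemma simplicial_boundary_expand:
  "simplicial_boundary k c
    = (\<Sum>\<sigma>\<in>Poly_Mapping.keys c. frag_cmul (Poly_Mapping.lookup c \<sigma>) (simplicial_boundary k (frag_of \<sigma>)))"
  by (simp add: simplicial_boundary_def frag_extend_def)

lemma simplicial_boundary_edge:
  assumes "u < v"
  shows "simplicial_boundary 1 (frag_of {u, v}) = frag_of {v} - frag_of {u}"
proof -
  have sum: "(\<Sum>x\<in>{u, v}. f x) = f u + f v" for f :: "_ \<Rightarrow> _ \<Rightarrow>\<^sub>0 int"
    using assms by simp
  have faces: "{w \<in> {u, v}. w < u} = {}" "{w \<in> {u, v}. w < v} = {u}" "{u, v} - {u} = {v}" "{u, v} - {v} = {u}"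
    using assms by auto
  show ?thesis
    unfolding simplicial_boundary_def frag_extend_of sum faces by simp
qed

lemma simplicial_boundary_triangle:
  assumes "u < v" "v < w"
  shows "simplicial_boundary 2 (frag_of {u, v, w}) = frag_of {v, w} - frag_of {u, w} + frag_of {u, v}"
proof -
  have sum: "(\<Sum>x\<in>{u, v, w}. f x) = f u + f v + f w" for f :: "_ \<Rightarrow> _ \<Rightarrow>\<^sub>0 int"
    using assms order.strict_trans[OF assms] by (simp add: less_imp_neq add.assoc)
  have faces: "{x \<in> {u, v, w}. x < u} = {}" "{x \<in> {u, v, w}. x < v} = {u}" "{x \<in> {u, v, w}. x < w} = {u, v}"
    "{u, v, w} - {u} = {v, w}" "{u, v, w} - {v} = {u, w}" "{u, v, w} - {w} = {u, v}"
    using assms by auto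
  show ?thesis
    unfolding simplicial_boundary_def frag_extend_of sum faces using assms by simp
qed

lemma card_3_sorted:
  fixes \<sigma> :: "'a::linorder set"
  assumes "card \<sigma> = 3"
  obtains u v w where "\<sigma> = {u, v, w}" "u < v" "v < w"
proof -
  obtain x y z where *: "\<sigma> = {x, y, z}" "x \<noteq> y" "y \<noteq> z" "x \<noteq> z"
    using assms by (auto simp: card_3_iff)
  consider "x < y" "y < z" | "x < z" "z < y" | "y < x" "x < z" | "y < z" "z < x" | "z < x" "x < y" | "z < y" "y < x"
    using * by (metis linorder_neqE)
  then show thesis
    using *(1) by cases (auto intro: that simp: insert_commute)
qed

lemma card_2_sorted:
  fixes \<sigma> :: "'a::linorder set"
  assumes "card \<sigma> = 2"
  obtains u v where "\<sigma> = {u, v}" "u < v"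
  using assms by (auto simp: card_2_iff) (metis insert_commute linorder_neqE)

lemma simplicial_boundary_boundary:
  fixes c :: "'a::linorder set \<Rightarrow>\<^sub>0 int"
  assumes "Poly_Mapping.keys c \<subseteq> {\<sigma>. card \<sigma> = 3}"
  shows "simplicial_boundary 1 (simplicial_boundary 2 c) = 0"
  using assms
proof (induction c rule: frag_induction)
  case (one \<sigma>)
  then obtain u v w where "\<sigma> = {u, v, w}" "u < v" "v < w"
    using card_3_sorted[of \<sigma>] by blast
  then show ?case
    by (simp add: simplicial_boundary_triangle simplicial_boundary_edge[simplified]
        simplicial_boundary_add simplicial_boundary_diff)
qed (simp_all add: simplicial_boundary_zero simplicial_boundary_diff)

text \<open>The cycles form a subgroup, so generating from them adds nothing, and the quotient
  consists of the cosets of the boundaries. The order of the homology group thus becomes a number of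
  cosets.\<close>

lemma carrier_simplicial_homology:
  "carrier (simplicial_homology k X)
    = (\<lambda>z. (\<lambda>b. b + z) ` simplicial_boundaries k X) ` simplicial_cycles k X"
proof -
  have "subgroup (simplicial_cycles k X) (simplicial_chains k X)"
  proof (rule group.subgroupI)
    show "group (simplicial_chains k X)" by (simp add: simplicial_chains_def)
    show "simplicial_cycles k X \<noteq> {}"
      using simplicial_boundary_zero by (auto simp: simplicial_cycles_def simplicial_chains_def intro!: exI[of _ 0])
    show "inv\<^bsub>simplicial_chains k X\<^esub> a \<in> simplicial_cycles k X" if "a \<in> simplicial_cycles k X" for a
      using that simplicial_boundary_cmul[of k "- 1" a] by (auto simp: simplicial_cycles_def simplicial_chains_def)
    show "a \<otimes>\<^bsub>simplicial_chains k X\<^esub> b \<in> simplicial_cycles k X"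
      if "a \<in> simplicial_cycles k X" "b \<in> simplicial_cycles k X" for a b
      using that keys_add[of a b] by (auto simp: simplicial_cycles_def simplicial_chains_def simplicial_boundary_add)
  qed (auto simp: simplicial_cycles_def)
  then have "carrier (subgroup_generated (simplicial_chains k X) (simplicial_cycles k X)) = simplicial_cycles k X"
    by (rule subgroup.carrier_subgroup_generated_subgroup)
  then show ?thesis
    unfolding simplicial_homology_def FactGroup_def RCOSETS_def r_coset_def
    by (auto simp: simplicial_chains_def)
qed

section \<open>Faces, cycles and boundaries of hypertrees\<close>

lemma hypertree_face:
  assumes "hypertree n S" "\<sigma> \<in> S"
  shows "\<sigma> \<noteq> {}" "\<sigma> \<subseteq> {1..n}" "card \<sigma> \<le> 3"
proof -
  have "\<forall>\<sigma>\<in>S. \<sigma> \<noteq> {} \<and> finite \<sigma> \<and> \<sigma> \<subseteq> {1..n}"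
    using assms(1) unfolding hypertree_def abstract_complex_def by (elim conjE)
  moreover have "\<forall>\<sigma>\<in>S. card \<sigma> \<le> 3"
    using assms(1) unfolding hypertree_def by (elim conjE)
  ultimately show "\<sigma> \<noteq> {}" "\<sigma> \<subseteq> {1..n}" "card \<sigma> \<le> 3"
    using assms(2) by blast+
qed

lemma hypertree_vertex: "hypertree n S \<Longrightarrow> v \<in> {1..n} \<Longrightarrow> {v} \<in> S"
  unfolding hypertree_def by (elim conjE) (rule bspec)

lemma hypertree_edge:
  assumes "hypertree n S" "u \<in> {1..n}" "v \<in> {1..n}" "u \<noteq> v"
  shows "{u, v} \<in> S"
proof -
  have "\<forall>u\<in>{1..n}. \<forall>v\<in>{1..n}. u \<noteq> v \<longrightarrow> {u, v} \<in> S"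
    using assms(1) unfolding hypertree_def by (elim conjE)
  then show ?thesis using assms(2-4) by blast
qed

lemma hypertree_edges:
  assumes "hypertree n S"
  shows "faces_of_dim 1 S = {\<sigma>. \<sigma> \<subseteq> {1..n} \<and> card \<sigma> = 2}"
proof (intro equalityI subsetI)
  fix \<sigma> assume "\<sigma> \<in> faces_of_dim 1 S"
  then show "\<sigma> \<in> {\<sigma>. \<sigma> \<subseteq> {1..n} \<and> card \<sigma> = 2}"
    using hypertree_face(2)[OF assms] by (auto simp: faces_of_dim_def)
next
  fix \<sigma> assume "\<sigma> \<in> {\<sigma>. \<sigma> \<subseteq> {1..n} \<and> card \<sigma> = 2}"
  then obtain u v where "\<sigma> = {u, v}" "u \<noteq> v" "u \<in> {1..n}" "v \<in> {1..n}"
    by (auto simp: card_2_iff)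
  then show "\<sigma> \<in> faces_of_dim 1 S"
    using hypertree_edge[OF assms, of u v] by (simp add: faces_of_dim_def)
qed

lemma hypertree_triangles:
  assumes "hypertree n S" "\<sigma> \<in> faces_of_dim 2 S"
  shows "\<sigma> \<subseteq> {1..n}" "card \<sigma> = 3"
  using assms(2) hypertree_face(2)[OF assms(1), of \<sigma>] by (auto simp: faces_of_dim_def)

text \<open>Vertices and edges are forced by the complete skeleton and there are no faces above
  dimension \<open>2\<close>, so only the triangles can differ.\<close>

lemma hypertree_eqI:
  assumes S: "hypertree n S" "hypertree n S'" and eq: "faces_of_dim 2 S = faces_of_dim 2 S'"
  shows "S = S'"
proof -
  have "S \<subseteq> S'" if S: "hypertree n S" "hypertree n S'" and eq: "faces_of_dim 2 S = faces_of_dim 2 S'" for S S'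
  proof
    fix \<sigma> assume \<sigma>: "\<sigma> \<in> S"
    note face = hypertree_face[OF S(1) \<sigma>]
    then have "card \<sigma> \<noteq> 0"
      using finite_subset[OF face(2)] by simp
    with face(3) consider "card \<sigma> = 1" | "card \<sigma> = 2" | "card \<sigma> = 3" by linarith
    then show "\<sigma> \<in> S'"
    proof cases
      case 1
      then show ?thesis
        using hypertree_vertex[OF S(2)] face(2) by (auto simp: card_1_singleton_iff)
    next
      case 2
      then have "\<sigma> \<in> faces_of_dim 1 S'" using face(2) unfolding hypertree_edges[OF S(2)] by simp
      then show ?thesis by (simp add: faces_of_dim_def)
    next
      case 3
      then have "\<sigma> \<in> faces_of_dim 2 S" using \<sigma> by (simp add: faces_of_dim_def)
      then have "\<sigma> \<in> faces_of_dim 2 S'" unfolding eq .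
      then show ?thesis by (simp add: faces_of_dim_def)
    qed
  qed
  then show ?thesis using assms by blast
qed

lemma finite_hypertrees: "finite {S. hypertree n S}"
  by (rule finite_subset[of _ "Pow (Pow {1..n})"]) (use hypertree_face(2) in auto)

abbreviation edge_set :: "nat \<times> nat \<Rightarrow> nat set" where
  "edge_set e \<equiv> {fst e, snd e}"

text \<open>A tree carries no nonzero cycle: if \<open>z\<close> lives on the star at
  \<open>1\<close>, then each \<open>v > 1\<close> is a leaf, and the boundary at \<open>{v}\<close>
  is the coefficient of \<open>{1, v}\<close>.\<close>

lemma cycle_eq_0:
  assumes S: "hypertree n S" and z: "z \<in> simplicial_cycles 1 S"
    and zero: "\<And>e. e \<in> reduced_pairs n \<Longrightarrow> Poly_Mapping.lookup z (edge_set e) = 0"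
  shows "z = 0"
proof (rule poly_mapping_eqI)
  fix \<sigma>
  have keys: "Poly_Mapping.keys z \<subseteq> {\<sigma>. \<sigma> \<subseteq> {1..n} \<and> card \<sigma> = 2}" and "simplicial_boundary 1 z = 0"
    using z hypertree_edges[OF S] by (auto simp: simplicial_cycles_def simplicial_chains_def)
  have star: "\<exists>w. \<sigma> = {1, w} \<and> 1 < w" if "\<sigma> \<in> Poly_Mapping.keys z" for \<sigma>
  proof -
    have \<sigma>: "\<sigma> \<subseteq> {1..n}" "card \<sigma> = 2" using keys that by auto
    then obtain u v where uv: "\<sigma> = {u, v}" "u < v"
      using card_2_sorted by blast
    then have "(u, v) \<notin> reduced_pairs n"
      using zero[of "(u, v)"] that by (auto simp: in_keys_iff)
    then have "u = 1" using uv \<sigma> by (auto simp: reduced_pairs_def)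
    then show ?thesis using uv by auto
  qed
  show "Poly_Mapping.lookup z \<sigma> = Poly_Mapping.lookup 0 \<sigma>"
  proof (cases "\<sigma> \<in> Poly_Mapping.keys z")
    case True
    then obtain v where v: "\<sigma> = {1, v}" "1 < v" using star by blast
    have "Poly_Mapping.lookup (simplicial_boundary 1 (frag_of \<tau>)) {v} = (if \<tau> = \<sigma> then 1 else 0)"
      if "\<tau> \<in> Poly_Mapping.keys z" for \<tau>
    proof -
      obtain w where w: "\<tau> = {1, w}" "1 < w" using star[OF \<open>\<tau> \<in> _\<close>] by blast
      have "\<tau> = \<sigma> \<longleftrightarrow> w = v" using v w by (auto simp: doubleton_eq_iff)
      then show ?thesis
        using v(2) w(2) unfolding w(1) simplicial_boundary_edge[OF w(2)] by (auto simp: lookup_minus)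
    qed
    then have "Poly_Mapping.lookup (simplicial_boundary 1 z) {v}
        = (\<Sum>\<tau>\<in>Poly_Mapping.keys z. Poly_Mapping.lookup z \<tau> * (if \<tau> = \<sigma> then 1 else 0))"
      by (subst simplicial_boundary_expand) (simp add: lookup_sum cong: sum.cong)
    also have "\<dots> = Poly_Mapping.lookup z \<sigma>"
      using True by (simp add: if_distrib[of "\<lambda>x. _ * x"] cong: if_cong)
    finally show ?thesis
      using \<open>simplicial_boundary 1 z = 0\<close> by simp
  qed (simp add: in_keys_iff)
qed

text \<open>Numbering the faces brings the boundaries into the form of
  \<open>column_span\<close>.\<close>

lemma simplicial_boundaries_eq:
  fixes N :: nat
  assumes t: "bij_betw t {..<N} (faces_of_dim (Suc k) X)"
  shows "simplicial_boundaries k X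
    = range (\<lambda>x. \<Sum>j<N. frag_cmul (x j) (simplicial_boundary (Suc k) (frag_of (t j))))"
proof (intro equalityI subsetI)
  fix b assume "b \<in> simplicial_boundaries k X"
  then obtain c where c: "Poly_Mapping.keys c \<subseteq> faces_of_dim (Suc k) X" "b = simplicial_boundary (Suc k) c"
    by (auto simp: simplicial_boundaries_def simplicial_chains_def)
  have fin: "finite (faces_of_dim (Suc k) X)"
    using bij_betw_finite[OF t] by simp
  have "b = (\<Sum>\<sigma>\<in>faces_of_dim (Suc k) X.
      frag_cmul (Poly_Mapping.lookup c \<sigma>) (simplicial_boundary (Suc k) (frag_of \<sigma>)))"
    unfolding c(2) simplicial_boundary_expand[of _ c]
    using c(1) fin by (intro sum.mono_neutral_left) (auto simp: in_keys_iff)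
  also have "\<dots> = (\<Sum>j<N. frag_cmul (Poly_Mapping.lookup c (t j)) (simplicial_boundary (Suc k) (frag_of (t j))))"
    by (rule sum.reindex_bij_betw[OF t, symmetric])
  finally show "b \<in> range (\<lambda>x. \<Sum>j<N. frag_cmul (x j) (simplicial_boundary (Suc k) (frag_of (t j))))"
    by (intro image_eqI[of _ _ "\<lambda>j. Poly_Mapping.lookup c (t j)"]) auto
next
  fix b assume "b \<in> range (\<lambda>x. \<Sum>j<N. frag_cmul (x j) (simplicial_boundary (Suc k) (frag_of (t j))))"
  then obtain x where "b = (\<Sum>j<N. frag_cmul (x j) (simplicial_boundary (Suc k) (frag_of (t j))))"
    by auto
  then have "b = simplicial_boundary (Suc k) (\<Sum>j<N. frag_cmul (x j) (frag_of (t j)))"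
    by (simp add: simplicial_boundary_sum simplicial_boundary_cmul)
  moreover have "Poly_Mapping.keys (\<Sum>j<N. frag_cmul (x j) (frag_of (t j))) \<subseteq> faces_of_dim (Suc k) X"
    using keys_sum[of "\<lambda>j. frag_cmul (x j) (frag_of (t j))" "{..<N}"] bij_betwE[OF t]
    by (auto simp: in_keys_iff split: if_splits)
  ultimately show "b \<in> simplicial_boundaries k X"
    by (auto simp: simplicial_boundaries_def simplicial_chains_def)
qed

text \<open>Restricting cycles to the edges that avoid the vertex \<open>1\<close> identifies the group of
  \<open>1\<close>-cycles with \<open>\<int>\<^sup>N\<close>, since the omitted edges form a spanning tree.\<close>

lemma order_homology_le_cdet:
  assumes S: "hypertree n S"
    and e: "bij_betw e {..<N} (reduced_pairs n)" and t: "bij_betw t {..<N} (faces_of_dim 2 S)"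
  shows "int (order (simplicial_homology 1 S))
    \<le> \<bar>cdet N (\<lambda>j i. Poly_Mapping.lookup (simplicial_boundary 2 (frag_of (t j))) (edge_set (e i)))\<bar>"
proof -
  define c where "c = (\<lambda>j i. Poly_Mapping.lookup (simplicial_boundary 2 (frag_of (t j))) (edge_set (e i)))"
  define Z where "Z = simplicial_cycles 1 S"
  define B where "B = simplicial_boundaries 1 S"
  define \<kappa> where "\<kappa> z = (\<lambda>b. b + z) ` B" for z
  define \<phi> where "\<phi> x = (\<Sum>j<N. frag_cmul (x j) (simplicial_boundary 2 (frag_of (t j))))" for x
  have H: "carrier (simplicial_homology 1 S) = \<kappa> ` Z"
    by (simp add: carrier_simplicial_homology \<kappa>_def B_def Z_def)
  have B: "B = range \<phi>"
    using simplicial_boundaries_eq[of t N 1 S] t by (simp add: B_def \<phi>_def numeral_2_eq_2)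
  have \<phi>_diff: "\<phi> x - \<phi> y = \<phi> (\<lambda>j. x j - y j)" and \<phi>_add: "\<phi> x + \<phi> y = \<phi> (\<lambda>j. x j + y j)" for x y
    by (simp_all add: \<phi>_def sum_subtractf sum.distrib frag_cmul_diff_distrib frag_cmul_distrib)
  have Z_diff: "a - b \<in> Z" if "a \<in> Z" "b \<in> Z" for a b
    using that keys_diff[of a b]
    by (auto simp: Z_def simplicial_cycles_def simplicial_chains_def simplicial_boundary_diff)
  have \<phi>_Z: "\<phi> x \<in> Z" for x
  proof -
    have "Poly_Mapping.keys (\<phi> x) \<subseteq> faces_of_dim 1 S"
    proof -
      have "Poly_Mapping.keys (simplicial_boundary 2 (frag_of (t j))) \<subseteq> faces_of_dim 1 S" if "j < N" for j
      proof -
        have "t j \<subseteq> {1..n}" "card (t j) = 3"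
          using hypertree_triangles[OF S] bij_betwE[OF t] that by auto
        then obtain u v w where uvw: "t j = {u, v, w}" "u < v" "v < w" "{u, v, w} \<subseteq> {1..n}"
          using card_3_sorted by metis
        show ?thesis
          unfolding hypertree_edges[OF S] uvw(1) simplicial_boundary_triangle[OF uvw(2,3)]
          using uvw by (auto simp: in_keys_iff lookup_add lookup_minus split: if_splits)
      qed
      then show ?thesis
        unfolding \<phi>_def using keys_sum[of _ "{..<N}"] by fastforce
    qed
    moreover have "simplicial_boundary 1 (\<phi> x) = 0"
    proof -
      have "simplicial_boundary 1 (simplicial_boundary 2 (frag_of (t j))) = 0" if "j < N" for j
        using hypertree_triangles[OF S] bij_betwE[OF t] that
        by (intro simplicial_boundary_boundary) (auto simp: keys_frag_of)
      then show ?thesis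
        by (simp add: \<phi>_def simplicial_boundary_sum simplicial_boundary_cmul)
    qed
    ultimately show ?thesis
      by (simp add: Z_def simplicial_cycles_def simplicial_chains_def)
  qed
  have lookup_\<phi>: "Poly_Mapping.lookup (\<phi> x) (edge_set (e i)) = (\<Sum>j<N. x j * c j i)" for x i
    by (simp add: \<phi>_def c_def lookup_sum)
  have \<kappa>_subset: "\<kappa> z \<subseteq> \<kappa> z'" if y: "z - z' = \<phi> y" for y z z'
  proof
    fix a assume "a \<in> \<kappa> z"
    then obtain x where "a = \<phi> x + z" unfolding \<kappa>_def B by (elim imageE) simp
    also have "\<dots> = \<phi> x + \<phi> y + z'" using y by (simp add: algebra_simps)
    also have "\<dots> = \<phi> (\<lambda>j. x j + y j) + z'" by (simp only: \<phi>_add)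
    finally show "a \<in> \<kappa> z'" unfolding \<kappa>_def B by simp
  qed
  have \<phi>_0: "\<phi> (\<lambda>_. 0) = 0" by (simp add: \<phi>_def)
  have \<kappa>_eq: "\<kappa> z = \<kappa> z'" if "z - z' \<in> B" for z z'
  proof -
    obtain y where y: "z - z' = \<phi> y" using \<open>z - z' \<in> B\<close> unfolding B by (elim rangeE)
    have "z' - z = \<phi> (\<lambda>_. 0) - \<phi> y" unfolding \<phi>_0 y[symmetric] by simp
    then have "z' - z = \<phi> (\<lambda>j. 0 - y j)" by (simp only: \<phi>_diff)
    with y show ?thesis by (intro equalityI \<kappa>_subset)
  qed
  have diff_B: "z - z' \<in> B" if "\<kappa> z = \<kappa> z'" for z z'
  proof -
    have "0 \<in> B" unfolding B \<phi>_0[symmetric] by (rule rangeI)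
    then have "0 + z \<in> \<kappa> z" unfolding \<kappa>_def by (rule imageI)
    then have "0 + z \<in> (\<lambda>b. b + z') ` B" unfolding that unfolding \<kappa>_def .
    then show ?thesis by (elim imageE) (simp add: algebra_simps)
  qed
  have pair: "1 < fst (e i)" "fst (e i) < snd (e i)" "snd (e i) \<le> n" if "i < N" for i
    using bij_betwE[OF e, rule_format, of i] that by (auto simp: reduced_pairs_def case_prod_beta)
  have edge_inj: "edge_set (e i) = edge_set (e i') \<longleftrightarrow> i = i'" if "i < N" "i' < N" for i i'
  proof -
    have "e i = e i'" if "edge_set (e i) = edge_set (e i')"
      using that pair[OF \<open>i < N\<close>] pair[OF \<open>i' < N\<close>] by (auto simp: doubleton_eq_iff prod_eq_iff)
    then show ?thesis
      using that bij_betw_imp_inj_on[OF e] by (auto dest: inj_onD)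
  qed
  have "\<exists>k. k \<noteq> 0 \<and> (\<lambda>i. k * v i) \<in> column_span N c" for v
  proof -
    \<comment> \<open>A combination of boundaries of the triangles formed by \<open>1\<close> and
      the edge \<open>e i\<close>. Such a boundary meets the reduced edges only in
      \<open>e i\<close>, so \<open>z\<close> is a cycle with prescribed coordinates
      \<open>v\<close>.\<close>
    define z where "z = (\<Sum>i<N. frag_cmul (v i)
        (frag_of (edge_set (e i)) - frag_of {1, snd (e i)} + frag_of {1, fst (e i)}))"
    have lookup_z: "Poly_Mapping.lookup z (edge_set (e i)) = v i" if "i < N" for i
    proof -
      have "Poly_Mapping.lookup (frag_of (edge_set (e i')) - frag_of {1, snd (e i')} + frag_of {1, fst (e i')}) (edge_set (e i))
          = (if i' = i then 1 else 0)" if "i' < N" for i'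
        using edge_inj[OF that \<open>i < N\<close>] pair[OF that] pair[OF \<open>i < N\<close>]
        by (auto simp: lookup_add lookup_minus doubleton_eq_iff)
      then show ?thesis
        using that by (simp add: z_def lookup_sum if_distrib[of "\<lambda>x. _ * x"] cong: if_cong)
    qed
    have "z \<in> Z"
    proof -
      have "simplicial_boundary 1 z = 0"
      proof -
        have "simplicial_boundary 1 (frag_of (edge_set (e i)) - frag_of {1, snd (e i)} + frag_of {1, fst (e i)}) = 0"
          if "i < N" for i
          using pair[OF that] simplicial_boundary_edge[of "fst (e i)" "snd (e i)"]
            simplicial_boundary_edge[of 1 "snd (e i)"] simplicial_boundary_edge[of 1 "fst (e i)"]
          by (simp only: simplicial_boundary_add simplicial_boundary_diff) simp
        then show ?thesis
          by (simp add: z_def simplicial_boundary_sum simplicial_boundary_cmul)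
      qed
      moreover have "Poly_Mapping.keys z \<subseteq> faces_of_dim 1 S"
      proof -
        have "Poly_Mapping.keys (frag_cmul (v i) (frag_of (edge_set (e i)) - frag_of {1, snd (e i)} + frag_of {1, fst (e i)}))
            \<subseteq> faces_of_dim 1 S" if "i < N" for i
          unfolding hypertree_edges[OF S] using pair[OF that]
          by (auto simp: in_keys_iff lookup_add lookup_minus split: if_splits)
        then show ?thesis
          unfolding z_def using keys_sum[of _ "{..<N}"] by fastforce
      qed
      ultimately show ?thesis
        by (simp add: Z_def simplicial_cycles_def simplicial_chains_def)
    qed
    then have kz: "frag_cmul k z \<in> Z" for k
      using keys_cmul[of k z] by (auto simp: Z_def simplicial_cycles_def simplicial_chains_def simplicial_boundary_cmul)
    have "finite (\<kappa> ` Z)"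
      using S H by (simp add: hypertree_def)
    moreover have "range (\<lambda>k. \<kappa> (frag_cmul k z)) \<subseteq> \<kappa> ` Z"
      using kz by (intro image_subsetI imageI)
    ultimately have fin: "finite (range (\<lambda>k. \<kappa> (frag_cmul k z)))"
      by (rule finite_subset[rotated])
    \<comment> \<open>Infinitely many multiples of \<open>z\<close> fall into finitely many homology
      classes. The difference of two multiples in one class is the required nonzero multiple in the
      span.\<close>
    have "\<not> inj (\<lambda>k. \<kappa> (frag_cmul k z))"
      using finite_imageD[OF fin] infinite_UNIV_int by argo
    then obtain k k' where k: "k \<noteq> k'" "\<kappa> (frag_cmul k z) = \<kappa> (frag_cmul k' z)"
      by (meson injI)
    have "frag_cmul (k - k') z \<in> B"
      using diff_B[OF k(2)] by (simp only: frag_cmul_diff_distrib)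
    then obtain x where x: "frag_cmul (k - k') z = \<phi> x"
      unfolding B by (elim rangeE)
    have "(k - k') * v i = (\<Sum>j<N. x j * c j i)" if "i < N" for i
      using arg_cong[OF x, of "\<lambda>f. Poly_Mapping.lookup f (edge_set (e i))"] that
      by (simp add: lookup_z lookup_\<phi>)
    then have "(\<lambda>i. (k - k') * v i) \<in> column_span N c"
      unfolding column_span_def by (intro CollectI exI[of _ x]) simp
    then show ?thesis
      using k(1) by (intro exI[of _ "k - k'"] conjI) simp_all
  qed
  from card_residues_le_cdet[of N c, OF this]
  obtain R where R: "finite R" "int (card R) \<le> \<bar>cdet N c\<bar>"
    and cover: "\<And>v. \<exists>r\<in>R. (\<lambda>i. v i - r i) \<in> column_span N c" by blast
  have "\<exists>r. r \<in> R \<and> (\<lambda>i. Poly_Mapping.lookup z (edge_set (e i)) - r i) \<in> column_span N c" for z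
    using cover[of "\<lambda>i. Poly_Mapping.lookup z (edge_set (e i))"] by (simp only: Bex_def)
  then have "\<exists>\<rho>. \<forall>z. \<rho> z \<in> R \<and> (\<lambda>i. Poly_Mapping.lookup z (edge_set (e i)) - \<rho> z i) \<in> column_span N c"
    by (intro choice allI)
  then obtain \<rho> where \<rho>: "\<And>z. \<rho> z \<in> R"
    "\<And>z. (\<lambda>i. Poly_Mapping.lookup z (edge_set (e i)) - \<rho> z i) \<in> column_span N c" by blast
  \<comment> \<open>Equal residues make \<open>z - z'\<close> agree with a boundary on the reduced
    edges, and a cycle vanishing there is \<open>0\<close>.\<close>
  have same: "\<kappa> z = \<kappa> z'" if z: "z \<in> Z" "z' \<in> Z" and eq: "\<rho> z = \<rho> z'" for z z'
  proof -
    obtain x y where x: "\<And>i. i < N \<Longrightarrow> Poly_Mapping.lookup z (edge_set (e i)) - \<rho> z i = (\<Sum>j<N. x j * c j i)"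
      and y: "\<And>i. i < N \<Longrightarrow> Poly_Mapping.lookup z' (edge_set (e i)) - \<rho> z' i = (\<Sum>j<N. y j * c j i)"
      using \<rho>(2)[of z] \<rho>(2)[of z'] unfolding column_span_def by auto
    have "z - z' - (\<phi> x - \<phi> y) = 0"
    proof (rule cycle_eq_0[OF S])
      show "z - z' - (\<phi> x - \<phi> y) \<in> simplicial_cycles 1 S"
        unfolding Z_def[symmetric] by (intro Z_diff \<phi>_Z z)
      show "Poly_Mapping.lookup (z - z' - (\<phi> x - \<phi> y)) (edge_set p) = 0" if p: "p \<in> reduced_pairs n" for p
      proof -
        obtain i where i: "i < N" "p = e i"
          using p bij_betw_imp_surj_on[OF e] by auto
        then show ?thesis
          using x[OF i(1)] y[OF i(1)] eq by (simp add: lookup_minus lookup_\<phi>)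
      qed
    qed
    then have "z - z' = \<phi> (\<lambda>j. x j - y j)" by (simp add: \<phi>_diff)
    then show ?thesis using \<kappa>_eq B by blast
  qed
  \<comment> \<open>The homology class of a cycle is determined by its residue, so there are at most
    \<open>card R\<close> classes.\<close>
  have "\<kappa> ` Z = (\<lambda>r. \<kappa> (inv_into Z \<rho> r)) ` \<rho> ` Z"
    unfolding image_image
    by (intro image_cong refl same) (auto intro: inv_into_into simp: f_inv_into_f)
  moreover have "finite (\<rho> ` Z)"
    using R(1) \<rho>(1) by (intro finite_subset[of "\<rho> ` Z" R] image_subsetI)
  ultimately have "card (\<kappa> ` Z) \<le> card (\<rho> ` Z)"
    by (simp only: card_image_le)
  also have "\<dots> \<le> card R"
    using R(1) \<rho>(1) by (intro card_mono) auto
  finally show ?thesis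
    using R(2) unfolding order_def H c_def[symmetric] by linarith
qed

section \<open>Weighted count of the hypertrees with triangles in a given set\<close>

text \<open>Each hypertree contributes at least \<open>fact N\<close> enumerations of its triangles,
  each with squared determinant at least the squared order. Different hypertrees give disjoint sets
  of enumerations, so the sum over all column choices dominates and \<open>fact N\<close> cancels.
  Boundary coefficients are \<open>0\<close> or \<open>1\<close> up to sign, so the squared norm of
  a row counts the triangles containing its edge.\<close>

lemma sum_order_homology_squared_le:
  assumes C: "C \<subseteq> {\<sigma>. \<sigma> \<subseteq> {1..n} \<and> card \<sigma> = 3}"
  shows "(\<Sum>S | hypertree n S \<and> faces_of_dim 2 S \<subseteq> C. (order (simplicial_homology 1 S))\<^sup>2)
    \<le> (\<Prod>p\<in>reduced_pairs n. card {\<sigma> \<in> C. edge_set p \<subseteq> \<sigma>})"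
proof -
  define N where "N = (n - 1) choose 2"
  let ?\<T> = "{S. hypertree n S \<and> faces_of_dim 2 S \<subseteq> C}"
  have finC: "finite C" using C by (rule finite_subset) (auto intro: finite_subset[of _ "Pow {1..n}"])
  have fin\<T>: "finite ?\<T>" using finite_hypertrees by (rule finite_subset[rotated]) auto
  have "finite (reduced_pairs n)"
    using finite_subset[OF reduced_pairs_subset finite_edge_pairs] .
  then obtain e where e: "bij_betw e {..<N} (reduced_pairs n)"
    using ex_bij_betw_nat_finite[of "reduced_pairs n"] by (auto simp: card_reduced_pairs N_def atLeast0LessThan)
  define r where "r = (\<lambda>\<sigma> i. Poly_Mapping.lookup (simplicial_boundary 2 (frag_of \<sigma>)) (edge_set (e i)))"
  define Bij where "Bij S = {c \<in> {..<N} \<rightarrow>\<^sub>E C. bij_betw c {..<N} (faces_of_dim 2 S)}" for S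
  have r_sq: "(r \<sigma> i)\<^sup>2 = (if edge_set (e i) \<subseteq> \<sigma> then 1 else 0)" if "\<sigma> \<in> C" "i < N" for \<sigma> i
  proof -
    obtain u v w where uvw: "\<sigma> = {u, v, w}" "u < v" "v < w"
      using C \<open>\<sigma> \<in> C\<close> card_3_sorted by (metis (mono_tags, lifting) mem_Collect_eq subsetD)
    have "e i \<in> reduced_pairs n"
      using bij_betwE[OF e] that by simp
    then obtain a b where ab: "e i = (a, b)" "a < b"
      by (auto simp: reduced_pairs_def)
    show ?thesis
      using uvw(2,3) ab(2) unfolding r_def uvw(1) simplicial_boundary_triangle[OF uvw(2,3)] ab(1)
      by (auto simp: lookup_add lookup_minus doubleton_eq_iff)
  qed
  \<comment> \<open>Composing one enumeration with the permutations of the indices yields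
    \<open>fact N\<close> different ones.\<close>
  have card_Bij: "card (Bij S) \<ge> fact N" if "S \<in> ?\<T>" for S
  proof -
    have "finite (faces_of_dim 2 S)"
      using that finC by (auto intro: finite_subset)
    moreover have "card (faces_of_dim 2 S) = N"
      using that by (simp add: hypertree_def N_def)
    ultimately obtain t where t: "bij_betw t {..<N} (faces_of_dim 2 S)"
      using ex_bij_betw_nat_finite[of "faces_of_dim 2 S"] by (auto simp: atLeast0LessThan)
    let ?f = "\<lambda>p. restrict (t \<circ> p) {..<N}"
    have sub: "?f ` {p. p permutes {..<N}} \<subseteq> Bij S"
    proof
      fix c assume "c \<in> ?f ` {p. p permutes {..<N}}"
      then obtain p where p: "p permutes {..<N}" "c = ?f p" by auto
      have "bij_betw (t \<circ> p) {..<N} (faces_of_dim 2 S)"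
        using bij_betw_trans[OF permutes_imp_bij[OF p(1)] t] .
      then have "bij_betw c {..<N} (faces_of_dim 2 S)"
        unfolding p(2) by (rule bij_betw_cong[THEN iffD1, rotated]) auto
      moreover from this have "c i \<in> C" if "i < N" for i
        using bij_betwE[of c] that \<open>S \<in> ?\<T>\<close> by auto
      moreover have "c \<in> extensional {..<N}"
        unfolding p(2) by simp
      ultimately show "c \<in> Bij S"
        by (simp add: Bij_def PiE_iff)
    qed
    have inj: "inj_on ?f {p. p permutes {..<N}}"
    proof (rule inj_onI)
      fix p q assume pq: "p \<in> {p. p permutes {..<N}}" "q \<in> {p. p permutes {..<N}}" "?f p = ?f q"
      show "p = q"
      proof
        fix i
        show "p i = q i"
        proof (cases "i < N")
          case True
          then have "t (p i) = t (q i)" using fun_cong[OF pq(3), of i] by simp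
          moreover have "p i < N" "q i < N"
            using pq True permutes_in_image[of _ "{..<N}" i] by auto
          ultimately show ?thesis
            using bij_betw_imp_inj_on[OF t] by (auto dest: inj_onD)
        next
          case False
          then show ?thesis using pq by (simp add: permutes_not_in)
        qed
      qed
    qed
    have "finite (Bij S)"
      using finC by (auto simp: Bij_def intro!: finite_PiE)
    then have "card {p. p permutes {..<N}} \<le> card (Bij S)"
      by (rule card_inj_on_le[OF inj sub])
    then show ?thesis by (simp add: card_permutations)
  qed
  have "fact N * (\<Sum>S\<in>?\<T>. (int (order (simplicial_homology 1 S)))\<^sup>2)
      \<le> (\<Sum>S\<in>?\<T>. \<Sum>c\<in>Bij S. (cdet N (r \<circ> c))\<^sup>2)"
    unfolding sum_distrib_left
  proof (rule sum_mono)
    fix S assume S: "S \<in> ?\<T>"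
    have "(int (order (simplicial_homology 1 S)))\<^sup>2 \<le> (cdet N (r \<circ> c))\<^sup>2" if "c \<in> Bij S" for c
    proof -
      have "int (order (simplicial_homology 1 S)) \<le> \<bar>cdet N (r \<circ> c)\<bar>"
        using order_homology_le_cdet[OF _ e, of S c] S that by (simp add: Bij_def r_def o_def)
      from power_mono[OF this, of 2] show ?thesis by simp
    qed
    then have "(\<Sum>c\<in>Bij S. (int (order (simplicial_homology 1 S)))\<^sup>2) \<le> (\<Sum>c\<in>Bij S. (cdet N (r \<circ> c))\<^sup>2)"
      by (rule sum_mono)
    moreover have "int (fact N) \<le> int (card (Bij S))"
      using card_Bij[OF S] by (rule of_nat_mono)
    then have "(fact N :: int) \<le> int (card (Bij S))"
      by (simp only: of_nat_fact)
    then have "fact N * (int (order (simplicial_homology 1 S)))\<^sup>2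
        \<le> int (card (Bij S)) * (int (order (simplicial_homology 1 S)))\<^sup>2"
      by (rule mult_right_mono) simp
    ultimately show "fact N * (int (order (simplicial_homology 1 S)))\<^sup>2 \<le> (\<Sum>c\<in>Bij S. (cdet N (r \<circ> c))\<^sup>2)"
      by simp
  qed
  also have "\<dots> = (\<Sum>c\<in>(\<Union>S\<in>?\<T>. Bij S). (cdet N (r \<circ> c))\<^sup>2)"
  proof (rule sum.UNION_disjoint[symmetric])
    show "\<forall>S\<in>?\<T>. \<forall>S'\<in>?\<T>. S \<noteq> S' \<longrightarrow> Bij S \<inter> Bij S' = {}"
    proof (intro ballI impI equals0I)
      fix S S' c assume "S \<in> ?\<T>" "S' \<in> ?\<T>" "S \<noteq> S'" "c \<in> Bij S \<inter> Bij S'"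
      moreover from this have "faces_of_dim 2 S = faces_of_dim 2 S'"
        by (auto simp: Bij_def bij_betw_def)
      ultimately show False
        using hypertree_eqI[of n S S'] by blast
    qed
    show "\<forall>S\<in>?\<T>. finite (Bij S)"
      using finC by (auto simp: Bij_def intro!: finite_PiE)
  qed (rule fin\<T>)
  also have "\<dots> \<le> (\<Sum>c\<in>{..<N} \<rightarrow>\<^sub>E C. (cdet N (r \<circ> c))\<^sup>2)"
    using finC by (intro sum_mono2) (auto simp: Bij_def intro!: finite_PiE)
  also have "\<dots> \<le> fact N * (\<Prod>i<N. \<Sum>\<sigma>\<in>C. (r \<sigma> i)\<^sup>2)"
    by (rule sum_cdet_squared_le[OF finC])
  also have "(\<Prod>i<N. \<Sum>\<sigma>\<in>C. (r \<sigma> i)\<^sup>2) = (\<Prod>i<N. int (card {\<sigma> \<in> C. edge_set (e i) \<subseteq> \<sigma>}))"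
  proof (intro prod.cong refl)
    fix i assume "i \<in> {..<N}"
    then have "(\<Sum>\<sigma>\<in>C. (r \<sigma> i)\<^sup>2) = (\<Sum>\<sigma>\<in>C. if edge_set (e i) \<subseteq> \<sigma> then 1 else 0)"
      by (intro sum.cong) (simp_all add: r_sq)
    also have "\<dots> = int (card {\<sigma> \<in> C. edge_set (e i) \<subseteq> \<sigma>})"
      using finC by (simp add: sum.If_cases Int_def)
    finally show "(\<Sum>\<sigma>\<in>C. (r \<sigma> i)\<^sup>2) = int (card {\<sigma> \<in> C. edge_set (e i) \<subseteq> \<sigma>})" .
  qed
  also have "\<dots> = int (\<Prod>p\<in>reduced_pairs n. card {\<sigma> \<in> C. edge_set p \<subseteq> \<sigma>})"
    unfolding of_nat_prod by (rule prod.reindex_bij_betw[OF e])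
  finally have "int (\<Sum>S\<in>?\<T>. (order (simplicial_homology 1 S))\<^sup>2)
      \<le> int (\<Prod>p\<in>reduced_pairs n. card {\<sigma> \<in> C. edge_set p \<subseteq> \<sigma>})"
    by simp
  then show ?thesis by (simp only: of_nat_le_iff)
qed

subsection \<open>The expected number of cocycles\<close>

definition closed_triangles ::
    "nat \<Rightarrow> ('g, 'm) monoid_scheme \<Rightarrow> (nat \<times> nat \<Rightarrow> 'g) \<Rightarrow> nat set set" where
  "closed_triangles n G h = {{u, v, w} | u v w.
     1 \<le> u \<and> u < v \<and> v < w \<and> w \<le> n \<and> h (u, v) \<otimes>\<^bsub>G\<^esub> h (v, w) = h (u, w)}"

lemma closed_triangles_subset: "closed_triangles n G h \<subseteq> {\<sigma>. \<sigma> \<subseteq> {1..n} \<and> card \<sigma> = 3}"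
  by (auto simp: closed_triangles_def)

text \<open>Every closed triangle over \<open>p\<close> arises from its third vertex. The three
  cases place that vertex last, in the middle or first.\<close>

lemma card_closed_triangles_le:
  fixes G :: "('g, 'm) monoid_scheme" (structure)
  assumes G: "group G" and h: "h \<in> edge_pairs n \<rightarrow>\<^sub>E carrier G" and p: "p \<in> reduced_pairs n"
  shows "card {\<sigma> \<in> closed_triangles n G h. edge_set p \<subseteq> \<sigma>} \<le> card (closing_vertices n G h p)"
proof -
  interpret group G by fact
  obtain a b where ab: "p = (a, b)" "a < b"
    using p by (auto simp: reduced_pairs_def)
  have fin: "finite (closing_vertices n G h p)"
    using finite_subset[OF closing_vertices_subset] by blast
  have "{\<sigma> \<in> closed_triangles n G h. edge_set p \<subseteq> \<sigma>} \<subseteq> (\<lambda>w. {a, b, w}) ` closing_vertices n G h p"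
  proof
    fix \<sigma> assume "\<sigma> \<in> {\<sigma> \<in> closed_triangles n G h. edge_set p \<subseteq> \<sigma>}"
    then obtain u v w where \<sigma>: "\<sigma> = {u, v, w}" and uvw: "1 \<le> u" "u < v" "v < w" "w \<le> n"
      and eq: "h (u, v) \<otimes> h (v, w) = h (u, w)" and sub: "{a, b} \<subseteq> {u, v, w}"
      by (auto simp: closed_triangles_def ab(1))
    have c: "h (u, v) \<in> carrier G" "h (v, w) \<in> carrier G" "h (u, w) \<in> carrier G"
      using uvw by ((intro PiE_mem[OF h]; simp add: edge_pairs_def)+)
    \<comment> \<open>The closing equation solved for the edge opposite the last vertex, and below
      in \<open>eq2\<close> for the edge opposite the first one.\<close>
    have eq1: "h (u, w) \<otimes> inv h (v, w) = h (u, v)"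
      unfolding eq[symmetric] using c by (simp add: m_assoc)
    have eq2: "inv h (u, v) \<otimes> h (u, w) = h (v, w)"
      unfolding eq[symmetric] using c by (simp add: m_assoc[symmetric])
    have "a = u \<or> a = v \<or> a = w" "b = u \<or> b = v \<or> b = w"
      using sub by simp_all
    then consider "a = u" "b = v" | "a = u" "b = w" | "a = v" "b = w"
      using ab(2) uvw by linarith
    then show "\<sigma> \<in> (\<lambda>w. {a, b, w}) ` closing_vertices n G h p"
    proof cases
      case 1
      then have "w \<in> closing_vertices n G h p"
        using uvw eq1 by (simp add: closing_vertices_def alternating_ext_def ab(1))
      moreover have "\<sigma> = {a, b, w}" using 1 \<sigma> by simp
      ultimately show ?thesis by (rule rev_image_eqI)
    next
      case 2
      then have "v \<in> closing_vertices n G h p"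
        using uvw eq by (simp add: closing_vertices_def alternating_ext_def ab(1))
      moreover have "\<sigma> = {a, b, v}" using 2 \<sigma> by (simp add: insert_commute)
      ultimately show ?thesis by (rule rev_image_eqI)
    next
      case 3
      then have "u \<in> closing_vertices n G h p"
        using uvw eq2 by (simp add: closing_vertices_def alternating_ext_def ab(1))
      moreover have "\<sigma> = {a, b, u}" using 3 \<sigma> by (simp add: insert_commute)
      ultimately show ?thesis by (rule rev_image_eqI)
    qed
  qed
  then have "card {\<sigma> \<in> closed_triangles n G h. edge_set p \<subseteq> \<sigma>}
      \<le> card ((\<lambda>w. {a, b, w}) ` closing_vertices n G h p)"
    using fin by (intro card_mono) auto
  also have "\<dots> \<le> card (closing_vertices n G h p)"
    by (rule card_image_le[OF fin])
  finally show ?thesis .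
qed

text \<open>By antisymmetry a cocycle is determined by its values on increasing pairs, and there the
  cocycle condition says that each triangle is closed.\<close>

lemma card_cocycles1_le:
  fixes G :: "('g, 'm) monoid_scheme" (structure)
  assumes G: "group G" "finite (carrier G)" and S: "hypertree n S"
  shows "card (cocycles1 n S G)
    \<le> card {h \<in> edge_pairs n \<rightarrow>\<^sub>E carrier G. faces_of_dim 2 S \<subseteq> closed_triangles n G h}"
proof (rule card_inj_on_le)
  interpret group G by fact
  let ?D = "{(u, v). u \<in> {1..n} \<and> v \<in> {1..n} \<and> u \<noteq> v}"
  let ?r = "\<lambda>f. restrict f (edge_pairs n)"
  have cocycle_PiE: "f \<in> ?D \<rightarrow>\<^sub>E carrier G" if "f \<in> cocycles1 n S G" for f
    using that unfolding cocycles1_def by (elim CollectE conjE)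
  have cocycle_swap: "f (u, v) = inv f (v, u)"
    if "f \<in> cocycles1 n S G" and uv: "u \<in> {1..n}" "v \<in> {1..n}" "u \<noteq> v" for f u v
  proof -
    have "\<forall>u\<in>{1..n}. \<forall>v\<in>{1..n}. u \<noteq> v \<longrightarrow> f (u, v) = inv f (v, u)"
      using that(1) unfolding cocycles1_def by (elim CollectE conjE)
    then show ?thesis using uv by blast
  qed
  have cocycle_closed: "f (u, v) \<otimes> f (v, w) \<otimes> f (w, u) = \<one>"
    if "f \<in> cocycles1 n S G" and uvw: "{u, v, w} \<in> faces_of_dim 2 S" for f u v w
  proof -
    have "\<forall>u v w. {u, v, w} \<in> faces_of_dim 2 S \<longrightarrow> f (u, v) \<otimes> f (v, w) \<otimes> f (w, u) = \<one>"
      using that(1) unfolding cocycles1_def by (elim CollectE conjE)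
    then show ?thesis using uvw by (elim allE impE)
  qed
  show "inj_on ?r (cocycles1 n S G)"
  proof (rule inj_onI)
    fix f g assume f: "f \<in> cocycles1 n S G" and g: "g \<in> cocycles1 n S G" and eq: "?r f = ?r g"
    have less: "f (u, v) = g (u, v)" if "u \<in> {1..n}" "v \<in> {1..n}" "u < v" for u v
      using fun_cong[OF eq, of "(u, v)"] that by (auto simp: edge_pairs_def)
    show "f = g"
    proof (rule PiE_ext[OF cocycle_PiE[OF f] cocycle_PiE[OF g]])
      fix p assume "p \<in> ?D"
      then obtain u v where p: "p = (u, v)" "u \<in> {1..n}" "v \<in> {1..n}" "u \<noteq> v" by auto
      show "f p = g p"
      proof (cases "u < v")
        case True
        then show ?thesis using less p by simp
      next
        case False
        then show ?thesis
          using cocycle_swap[OF f, of u v] cocycle_swap[OF g, of u v] less[of v u] p by simp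
      qed
    qed
  qed
  show "?r ` cocycles1 n S G \<subseteq> {h \<in> edge_pairs n \<rightarrow>\<^sub>E carrier G. faces_of_dim 2 S \<subseteq> closed_triangles n G h}"
  proof (intro image_subsetI CollectI conjI)
    fix f assume f: "f \<in> cocycles1 n S G"
    have mem: "f (u, v) \<in> carrier G" if "u \<in> {1..n}" "v \<in> {1..n}" "u \<noteq> v" for u v
      using PiE_mem[OF cocycle_PiE[OF f], of "(u, v)"] that by simp
    then show "?r f \<in> edge_pairs n \<rightarrow>\<^sub>E carrier G"
      by (intro restrict_PiE_iff[THEN iffD2]) (auto simp: edge_pairs_def)
    show "faces_of_dim 2 S \<subseteq> closed_triangles n G (?r f)"
    proof
      fix \<sigma> assume \<sigma>: "\<sigma> \<in> faces_of_dim 2 S"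
      obtain u v w where uvw: "\<sigma> = {u, v, w}" "u < v" "v < w"
        using card_3_sorted[OF hypertree_triangles(2)[OF S \<sigma>]] by blast
      have range: "u \<in> {1..n}" "v \<in> {1..n}" "w \<in> {1..n}"
        using hypertree_triangles(1)[OF S \<sigma>] uvw(1) by auto
      have c: "f (u, v) \<in> carrier G" "f (v, w) \<in> carrier G" "f (u, w) \<in> carrier G"
        using mem range uvw by auto
      have "f (w, u) = inv f (u, w)"
        using cocycle_swap[OF f, of w u] range uvw by simp
      then have "(f (u, v) \<otimes> f (v, w)) \<otimes> inv f (u, w) = \<one>"
        using cocycle_closed[OF f, of u v w] \<sigma> uvw(1) by simp
      then have "f (u, v) \<otimes> f (v, w) = f (u, w)"
        using c inv_equality[of "f (u, v) \<otimes> f (v, w)" "inv f (u, w)"] by simp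
      moreover have "(u, v) \<in> edge_pairs n" "(v, w) \<in> edge_pairs n" "(u, w) \<in> edge_pairs n"
        using range uvw by (auto simp: edge_pairs_def)
      ultimately have "1 \<le> u \<and> u < v \<and> v < w \<and> w \<le> n \<and> ?r f (u, v) \<otimes> ?r f (v, w) = ?r f (u, w)"
        using range uvw by simp
      then show "\<sigma> \<in> closed_triangles n G (?r f)"
        unfolding closed_triangles_def uvw(1) by blast
    qed
  qed
  show "finite {h \<in> edge_pairs n \<rightarrow>\<^sub>E carrier G. faces_of_dim 2 S \<subseteq> closed_triangles n G h}"
    by (rule finite_subset[OF _ finite_PiE[OF finite_edge_pairs G(2)]]) auto
qed

text \<open>The trivial cocycle is a witness.\<close>

lemma card_cocycles1_ge_1:
  fixes G :: "('g, 'm) monoid_scheme" (structure)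
  assumes G: "group G" "finite (carrier G)" and S: "hypertree n S"
  shows "card (cocycles1 n S G) \<ge> 1"
proof -
  interpret group G by fact
  let ?D = "{(u, v). u \<in> {1..n} \<and> v \<in> {1..n} \<and> u \<noteq> v}"
  let ?f = "restrict (\<lambda>_. \<one>) ?D"
  have closed: "?f (u, v) \<otimes> ?f (v, w) \<otimes> ?f (w, u) = \<one>" if "{u, v, w} \<in> faces_of_dim 2 S" for u v w
  proof -
    have "{u, v, w} \<subseteq> {1..n}" "u \<noteq> v" "v \<noteq> w" "w \<noteq> u"
      using hypertree_triangles[OF S that] by (auto simp: card_insert_if split: if_splits)
    then show ?thesis by simp
  qed
  have "?f \<in> cocycles1 n S G"
    unfolding cocycles1_def
  proof (intro CollectI conjI ballI impI allI)
    show "?f \<in> ?D \<rightarrow>\<^sub>E carrier G" by (simp add: restrict_PiE_iff)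
  qed (simp, rule closed)
  then have "cocycles1 n S G \<noteq> {}" by blast
  moreover have "finite ?D"
    by (rule finite_subset[of _ "{1..n} \<times> {1..n}"]) auto
  then have "finite (?D \<rightarrow>\<^sub>E carrier G)"
    by (rule finite_PiE[OF _ G(2)])
  then have "finite (cocycles1 n S G)"
    by (rule finite_subset[rotated]) (unfold cocycles1_def, rule Collect_restrict)
  ultimately show ?thesis
    by (simp add: Suc_le_eq card_gt_0_iff)
qed

section \<open>Expectations over the random hypertree\<close>

text \<open>There are only finitely many hypertrees, so \<open>F (T \<omega>)\<close> is a finite
  combination of indicators of events.\<close>

lemma expectation_determinantal_hypertree:
  fixes F :: "nat set set \<Rightarrow> real"
  assumes "determinantal_hypertree n M T"
  shows "prob_space.expectation M (\<lambda>\<omega>. F (T \<omega>)) = (\<Sum>S | hypertree n S.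
    (real (order (simplicial_homology 1 S)))\<^sup>2 / real n ^ ((n - 2) choose 2) * F S)"
proof -
  let ?H = "{S. hypertree n S}"
  interpret prob_space M using assms by (simp add: determinantal_hypertree_def)
  have T: "T \<in> measurable M (count_space ?H)"
    and prob: "\<And>S. hypertree n S \<Longrightarrow> measure M {\<omega> \<in> space M. T \<omega> = S}
      = (real (order (simplicial_homology 1 S)))\<^sup>2 / real n ^ ((n - 2) choose 2)"
    using assms by (simp_all add: determinantal_hypertree_def)
  define A where "A S = {\<omega> \<in> space M. T \<omega> = S}" for S
  have A: "A S \<in> sets M" if "S \<in> ?H" for S
  proof -
    have "A S = T -` {S} \<inter> space M" by (auto simp: A_def)
    then show ?thesis using measurable_sets[OF T, of "{S}"] that by simp
  qed
  have "expectation (\<lambda>\<omega>. F (T \<omega>)) = expectation (\<lambda>\<omega>. \<Sum>S\<in>?H. F S * indicator (A S) \<omega>)"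
  proof (rule Bochner_Integration.integral_cong[OF refl])
    fix \<omega> assume \<omega>: "\<omega> \<in> space M"
    then have "T \<omega> \<in> ?H" using measurable_space[OF T \<omega>] by simp
    have "(\<Sum>S\<in>?H. F S * indicator (A S) \<omega>) = (\<Sum>S\<in>?H. if T \<omega> = S then F S else 0)"
      using \<omega> by (intro sum.cong) (auto simp: A_def indicator_def)
    also have "\<dots> = F (T \<omega>)"
      using \<open>T \<omega> \<in> ?H\<close> finite_hypertrees by (simp add: sum.delta')
    finally show "F (T \<omega>) = (\<Sum>S\<in>?H. F S * indicator (A S) \<omega>)" by simp
  qed
  also have "\<dots> = (\<Sum>S\<in>?H. expectation (\<lambda>\<omega>. F S * indicator (A S) \<omega>))"
    using A by (intro Bochner_Integration.integral_sum integrable_mult_right integrable_real_indicator)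
      (auto simp: less_top[symmetric])
  also have "\<dots> = (\<Sum>S\<in>?H. measure M (A S) * F S)"
    using A by (intro sum.cong) (auto simp: sets.Int_space_eq2 mult.commute)
  finally show ?thesis
    using prob by (simp add: A_def)
qed

text \<open>This makes the logarithm in the theorem nonnegative. The expectation formula for the
  constant \<open>1\<close> shows that the weights add up to \<open>1\<close>.\<close>

lemma expectation_card_cocycles1_ge_1:
  assumes G: "group G" "finite (carrier G)" and T: "determinantal_hypertree n M T"
  shows "prob_space.expectation M (\<lambda>\<omega>. real (card (cocycles1 n (T \<omega>) G))) \<ge> 1"
proof -
  interpret prob_space M using T by (simp add: determinantal_hypertree_def)
  have "(1::real) = expectation (\<lambda>\<omega>. 1)"
    by (simp add: prob_space)
  also have "\<dots> = (\<Sum>S | hypertree n S.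
      (real (order (simplicial_homology 1 S)))\<^sup>2 / real n ^ ((n - 2) choose 2) * 1)"
    using expectation_determinantal_hypertree[OF T, of "\<lambda>_. 1"] .
  also have "\<dots> \<le> (\<Sum>S | hypertree n S.
      (real (order (simplicial_homology 1 S)))\<^sup>2 / real n ^ ((n - 2) choose 2) * real (card (cocycles1 n S G)))"
    using card_cocycles1_ge_1[OF G] by (intro sum_mono mult_left_mono) auto
  also have "\<dots> = expectation (\<lambda>\<omega>. real (card (cocycles1 n (T \<omega>) G)))"
    using expectation_determinantal_hypertree[OF T, of "\<lambda>S. real (card (cocycles1 n S G))"] by (rule sym)
  finally show ?thesis .
qed

text \<open>After exchanging the sums over hypertrees and labellings, each labelling
  \<open>h\<close> contributes the weight of the hypertrees whose triangles it closes, bounded by a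
  product over the reduced edges. Dividing each factor by \<open>n\<close> leaves the quotient
  \<open>n ^ N / q\<close>.\<close>

lemma expectation_card_cocycles1_le:
  fixes G :: "('g, 'm) monoid_scheme"
  assumes G: "group G" "finite (carrier G)" and T: "determinantal_hypertree n M T" and n: "n \<ge> 2"
  defines "m \<equiv> real (card (carrier G))"
  shows "prob_space.expectation M (\<lambda>\<omega>. real (card (cocycles1 n (T \<omega>) G)))
    \<le> real n ^ (n - 2) * (real n ^ k * ((real k + m) / real (Suc k)) ^ ((n - 1) choose 2) * m ^ ((2 * k + 1) * n))"
proof -
  let ?H = "{S. hypertree n S}"
  define Fs where "Fs = edge_pairs n \<rightarrow>\<^sub>E carrier G"
  define C where "C = closed_triangles n G"
  define w where "w S = (real (order (simplicial_homology 1 S)))\<^sup>2" for S :: "nat set set"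
  define q where "q = real n ^ ((n - 2) choose 2)"
  define N where "N = (n - 1) choose 2"
  have q: "q > 0" using n by (simp add: q_def)
  have finFs: "finite Fs"
    unfolding Fs_def by (intro finite_PiE finite_edge_pairs G)
  have fin: "finite ?H" by (rule finite_hypertrees)
  have "prob_space.expectation M (\<lambda>\<omega>. real (card (cocycles1 n (T \<omega>) G)))
      = (\<Sum>S\<in>?H. w S / q * real (card (cocycles1 n S G)))"
    unfolding w_def q_def by (rule expectation_determinantal_hypertree[OF T])
  also have "\<dots> \<le> (\<Sum>S\<in>?H. w S / q * (\<Sum>h\<in>Fs. if faces_of_dim 2 S \<subseteq> C h then 1 else 0))"
  proof (intro sum_mono mult_left_mono)
    fix S assume "S \<in> ?H"
    then have "card (cocycles1 n S G) \<le> card {h \<in> Fs. faces_of_dim 2 S \<subseteq> C h}"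
      unfolding Fs_def C_def by (intro card_cocycles1_le[OF G]) simp
    also have "real \<dots> = (\<Sum>h\<in>Fs. if faces_of_dim 2 S \<subseteq> C h then 1 else 0)"
      using finFs by (simp add: sum.If_cases Int_def)
    finally show "real (card (cocycles1 n S G)) \<le> (\<Sum>h\<in>Fs. if faces_of_dim 2 S \<subseteq> C h then 1 else 0)"
      by simp
  qed (use q in \<open>simp add: w_def\<close>)
  also have "\<dots> = (\<Sum>h\<in>Fs. \<Sum>S\<in>?H. if faces_of_dim 2 S \<subseteq> C h then w S else 0) / q"
    unfolding sum_distrib_left sum_divide_distrib
    by (subst sum.swap) (intro sum.cong refl, simp)
  also have "\<dots> \<le> (\<Sum>h\<in>Fs. \<Prod>p\<in>reduced_pairs n. real (card (closing_vertices n G h p))) / q"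
  proof (intro divide_right_mono sum_mono)
    fix h assume h: "h \<in> Fs"
    have "(\<Sum>S\<in>?H. if faces_of_dim 2 S \<subseteq> C h then w S else 0)
        = (\<Sum>S | hypertree n S \<and> faces_of_dim 2 S \<subseteq> C h. w S)"
      using fin by (simp add: sum.If_cases Int_def)
    also have "\<dots> = real (\<Sum>S | hypertree n S \<and> faces_of_dim 2 S \<subseteq> C h. (order (simplicial_homology 1 S))\<^sup>2)"
      by (simp add: w_def)
    also have "\<dots> \<le> real (\<Prod>p\<in>reduced_pairs n. card {\<sigma> \<in> C h. edge_set p \<subseteq> \<sigma>})"
      unfolding C_def by (intro of_nat_mono sum_order_homology_squared_le closed_triangles_subset)
    also have "\<dots> \<le> (\<Prod>p\<in>reduced_pairs n. real (card (closing_vertices n G h p)))"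
      unfolding of_nat_prod C_def
      using h by (intro prod_mono conjI of_nat_mono card_closed_triangles_le[OF G(1)]) (auto simp: Fs_def)
    finally show "(\<Sum>S\<in>?H. if faces_of_dim 2 S \<subseteq> C h then w S else 0)
        \<le> (\<Prod>p\<in>reduced_pairs n. real (card (closing_vertices n G h p)))" .
  qed (use q in simp)
  also have "\<dots> = real n ^ N / q *
      (\<Sum>h\<in>Fs. \<Prod>p\<in>reduced_pairs n. real (card (closing_vertices n G h p)) / real n)"
    using n by (simp add: prod_dividef card_reduced_pairs N_def sum_divide_distrib[symmetric])
  also have "real n ^ N / q = real n ^ (n - 2)"
  proof -
    \<comment> \<open>Pascal's rule splits the exponent \<open>N\<close>, so the powers of
      \<open>n\<close> cancel up to the exponent \<open>n - 2\<close>.\<close>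
    have "n - 1 = Suc (n - 2)" using n by simp
    then have "N = (n - 2) + ((n - 2) choose 2)"
      unfolding N_def numeral_2_eq_2 by (simp only: binomial_Suc_Suc choose_one flip: One_nat_def)
    then have "real n ^ N = real n ^ (n - 2) * q"
      by (simp only: q_def power_add)
    then show ?thesis using q by simp
  qed
  also have "real n ^ (n - 2) * (\<Sum>h\<in>Fs. \<Prod>p\<in>reduced_pairs n. real (card (closing_vertices n G h p)) / real n)
      \<le> real n ^ (n - 2) * (real n ^ k * ((real k + m) / real (Suc k)) ^ ((n - 1) choose 2) * m ^ ((2 * k + 1) * n))"
    unfolding Fs_def m_def using n monoid.one_closed[OF group.is_monoid[OF G(1)]] G(2)
    by (intro mult_left_mono sum_prod_closing_vertices_le) auto
  finally show ?thesis .
qed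

theorem theorem1:
  fixes G :: "('g, 'm) monoid_scheme"
    and M :: "nat \<Rightarrow> 'a measure"
    and T :: "nat \<Rightarrow> 'a \<Rightarrow> nat set set"
  assumes "comm_group G" and "finite (carrier G)"
    and "\<And>n. n \<ge> 3 \<Longrightarrow> determinantal_hypertree n (M n) (T n)"
  shows "(\<lambda>n. ln (prob_space.expectation (M n) (\<lambda>\<omega>. real (card (cocycles1 n (T n \<omega>) G))))
               / real n ^ 2) \<longlonglongrightarrow> 0"
proof (rule LIMSEQ_I)
  fix \<epsilon> :: real assume \<epsilon>: "\<epsilon> > 0"
  have G: "group G" "finite (carrier G)"
    using assms by (auto simp: comm_group_def)
  define E where "E n = prob_space.expectation (M n) (\<lambda>\<omega>. real (card (cocycles1 n (T n \<omega>) G)))" for n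
  define m where "m = real (card (carrier G))"
  have m: "m \<ge> 1"
    using G monoid.one_closed[OF group.is_monoid[OF G(1)]] by (auto simp: m_def Suc_le_eq card_gt_0_iff)
  \<comment> \<open>The choice gives \<open>(m - 1) / (k + 1) < \<epsilon> / 2\<close>, which bounds
    \<open>ln \<rho>\<close>. The integer \<open>k\<close> is fixed before \<open>n\<close>
    grows.\<close>
  obtain k :: nat where k: "m / (\<epsilon> / 2) < real k"
    using reals_Archimedean2 by blast
  define \<rho> where "\<rho> = (real k + m) / real (Suc k)"
  have \<rho>: "\<rho> \<ge> 1" using m by (simp add: \<rho>_def)
  have "ln \<rho> \<le> \<rho> - 1" using \<rho> by (intro ln_le_minus_one) simp
  also have "\<dots> = (m - 1) / real (Suc k)" by (simp add: \<rho>_def field_simps)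
  also have "\<dots> < \<epsilon> / 2"
    using k \<epsilon> m by (simp add: field_simps)
  finally have ln_\<rho>: "ln \<rho> < \<epsilon> / 2" .
  have bound: "ln (E n) / real n ^ 2
      \<le> ((real n + real k) * ln (real n) + real n * (real (2 * k + 1) * ln m)) / real n ^ 2 + ln \<rho>"
    if n: "n \<ge> 3" for n
  proof -
    let ?N = "(n - 1) choose 2"
    have "E n \<ge> 1"
      unfolding E_def using expectation_card_cocycles1_ge_1[OF G assms(3)[OF n]] .
    have "E n \<le> real n ^ (n - 2) * (real n ^ k * \<rho> ^ ?N * m ^ ((2 * k + 1) * n))"
      unfolding E_def \<rho>_def m_def using expectation_card_cocycles1_le[OF G assms(3)[OF n]] n by simp
    then have "ln (E n) \<le> ln (real n ^ (n - 2) * (real n ^ k * \<rho> ^ ?N * m ^ ((2 * k + 1) * n)))"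
      using \<open>E n \<ge> 1\<close> by (intro ln_mono) auto
    also have "\<dots> = real (n - 2) * ln (real n) + (real k * ln (real n) + real ?N * ln \<rho>
        + real ((2 * k + 1) * n) * ln m)"
      using n m \<rho> by (simp add: ln_mult ln_realpow del: of_nat_mult)
    also have "\<dots> \<le> real n * ln (real n) + (real k * ln (real n) + real n ^ 2 * ln \<rho>
        + real ((2 * k + 1) * n) * ln m)"
    proof (intro add_mono mult_right_mono order_refl)
      \<comment> \<open>A crude bound suffices, because its factor \<open>ln \<rho>\<close> is
        nonnegative and already below \<open>\<epsilon> / 2\<close>.\<close>
      have "?N \<le> (n - 1) * (n - 1 - 1)"
        unfolding choose_two by (rule div_le_dividend)
      also have "\<dots> \<le> n ^ 2"
        unfolding power2_eq_square by (intro mult_le_mono) auto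
      finally show "real ?N \<le> real n ^ 2" by (simp flip: of_nat_power)
    qed (use n m \<rho> in auto)
    finally have "ln (E n) / real n ^ 2 \<le> (real n * ln (real n) + (real k * ln (real n) + real n ^ 2 * ln \<rho>
        + real ((2 * k + 1) * n) * ln m)) / real n ^ 2"
      by (intro divide_right_mono) auto
    also have "\<dots> = ((real n + real k) * ln (real n) + real n * (real (2 * k + 1) * ln m)) / real n ^ 2 + ln \<rho>"
      using n by (simp add: field_simps)
    finally show ?thesis .
  qed
  \<comment> \<open>The sample size and the labels on \<open>E\<^sub>0\<close> only cost terms of
    order \<open>n * ln n\<close>.\<close>
  have "(\<lambda>n. ((real n + a) * ln (real n) + real n * b) / real n ^ 2) \<longlonglongrightarrow> 0" for a b :: real
    by real_asymp
  from order_tendstoD(2)[OF this[of "real k" "real (2 * k + 1) * ln m"], of "\<epsilon> / 2"]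
  obtain n\<^sub>0 where n\<^sub>0: "\<And>n. n \<ge> n\<^sub>0 \<Longrightarrow>
      ((real n + real k) * ln (real n) + real n * (real (2 * k + 1) * ln m)) / real n ^ 2 < \<epsilon> / 2"
    using \<epsilon> unfolding eventually_sequentially by auto
  have "norm (ln (E n) / real n ^ 2 - 0) < \<epsilon>" if n: "n \<ge> max 3 n\<^sub>0" for n
  proof -
    have "ln (E n) \<ge> 0"
      unfolding E_def using expectation_card_cocycles1_ge_1[OF G assms(3)[of n]] n by simp
    moreover have "ln (E n) / real n ^ 2 < \<epsilon>"
      using bound[of n] n\<^sub>0[of n] ln_\<rho> n by linarith
    ultimately show ?thesis by simp
  qed
  then show "\<exists>n\<^sub>0. \<forall>n\<ge>n\<^sub>0. norm (ln (prob_space.expectation (M n)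
      (\<lambda>\<omega>. real (card (cocycles1 n (T n \<omega>) G)))) / real n ^ 2 - 0) < \<epsilon>"
    unfolding E_def by blast
qed

end
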